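(* Let $r\ge 1$ be an integer and let $M$ be a simple module over the Lie algebra $\mathfrak{a}_r$ such that the action of $\bar d_r$ on $M$ is injective. Then for any $\beta\in\mathbb{C}[t,t^{-1}]\setminus\mathbb{C}$, the Virasoro module $\mathcal{N}(M,\beta)$ is simple.
   Context: The Virasoro algebra $\mathfrak{V}$ is the complex Lie algebra with basis $\{c,d_i: i\in\mathbb{Z}\}$ and bracket $[d_i,d_j]=(j-i)d_{i+j}+\delta_{i,-j}\frac{i^3-i}{12}c$, $[d_i,c]=0$ for $i,j\in\mathbb{Z}$. Let $\mathfrak{V}_+$ be the Lie subalgebra of $\mathfrak{V}$ spanned by all $d_i$ with $i\geq 0$. For an integer $r\ge 0$ let $\mathfrak{V}_+^{(r)}$ be the Lie subalgebra generated by all $d_i$ with $i>r$ (it is an ideal of $\mathfrak{V}_+$), let $\mathfrak{a}_r=\mathfrak{V}_+/\mathfrak{V}_+^{(r)}$, and let $\bar d_i$ be the image of $d_i$ in $\mathfrak{a}_r$. For an $\mathfrak{a}_r$-module $M$, $\mathcal{N}(M,0)$ is the $\mathfrak{V}$-module with underlying vector space $M\otimes\mathbb{C}[t,t^{-1}]$ and action $$d_m (v\otimes t^n)=\Big(\Big(n+\sum_{i=0}^r\frac{m^{i+1}}{(i+1)!}\bar d_i\Big)v\Big)\otimes t^{n+m},\qquad c(v\otimes t^n)=0\qquad (m,n\in\mathbb{Z},\ v\in M).$$ The algebra $\mathbb{C}[t,t^{-1}]$ acts on this space by multiplication on the second factor: $t^k(v\otimes t^n)=v\otimes t^{n+k}$,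 extended linearly. For $\beta\in\mathbb{C}[t,t^{-1}]$, $\mathcal{N}(M,\beta)$ denotes the $\mathfrak{V}$-module with the same underlying space $M\otimes\mathbb{C}[t,t^{-1}]$ and the new action $$d_n\circ w=(d_n+\beta t^n)w,\qquad c\circ w=0\qquad (n\in\mathbb{Z},\ w\in \mathcal{N}(M,0)),$$ where $d_nw$ is the action in $\mathcal{N}(M,0)$ and $\beta t^n\in\mathbb{C}[t,t^{-1}]$ acts by multiplication. *)

theory Defs
  imports
    "HOL-Algebra.Algebraic_Closure_Type"
    "HOL-Library.Poly_Mapping"
begin

section \<open>Lie algebras over the complex numbers\<close>

abbreviation complex_ring :: "complex ring"
  where "complex_ring \<equiv> ring_of_type_algebra"

text \<open>
  A Lie algebra is a non-associative algebra, so it is stored in the record type of modules with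
  the Lie bracket in the \<open>mult\<close> field: \<open>x \<otimes>\<^bsub>L\<^esub> y\<close> is the bracket of \<open>x\<close> and \<open>y\<close>.
  The field \<open>one\<close> is never used.
\<close>

locale lie_algebra = module complex_ring L for L (structure) +
  assumes bracket_closed: "\<lbrakk>x \<in> carrier L; y \<in> carrier L\<rbrakk> \<Longrightarrow> x \<otimes> y \<in> carrier L"
    and bracket_add_left: "\<lbrakk>x \<in> carrier L; y \<in> carrier L; z \<in> carrier L\<rbrakk>
      \<Longrightarrow> (x \<oplus> y) \<otimes> z = (x \<otimes> z) \<oplus> (y \<otimes> z)"
    and bracket_add_right: "\<lbrakk>x \<in> carrier L; y \<in> carrier L; z \<in> carrier L\<rbrakk>
      \<Longrightarrow> x \<otimes> (y \<oplus> z) = (x \<otimes> y) \<oplus> (x \<otimes> z)"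
    and bracket_smult_left: "\<lbrakk>x \<in> carrier L; y \<in> carrier L\<rbrakk> \<Longrightarrow> (a \<odot> x) \<otimes> y = a \<odot> (x \<otimes> y)"
    and bracket_smult_right: "\<lbrakk>x \<in> carrier L; y \<in> carrier L\<rbrakk> \<Longrightarrow> x \<otimes> (a \<odot> y) = a \<odot> (x \<otimes> y)"
    and bracket_self: "x \<in> carrier L \<Longrightarrow> x \<otimes> x = \<zero>"
    and jacobi: "\<lbrakk>x \<in> carrier L; y \<in> carrier L; z \<in> carrier L\<rbrakk>
      \<Longrightarrow> (x \<otimes> (y \<otimes> z)) \<oplus> (y \<otimes> (z \<otimes> x)) \<oplus> (z \<otimes> (x \<otimes> y)) = \<zero>"

definition lie_subalgebra :: "(complex, 'g) module \<Rightarrow> 'g set \<Rightarrow> bool"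
  where "lie_subalgebra L H \<longleftrightarrow>
    submodule H complex_ring L \<and> (\<forall>x\<in>H. \<forall>y\<in>H. x \<otimes>\<^bsub>L\<^esub> y \<in> H)"

definition lie_generated :: "(complex, 'g) module \<Rightarrow> 'g set \<Rightarrow> 'g set"
  where "lie_generated L S = lie_subalgebra L hull S"

definition lie_ideal :: "(complex, 'g) module \<Rightarrow> 'g set \<Rightarrow> bool"
  where "lie_ideal L I \<longleftrightarrow>
    submodule I complex_ring L \<and> (\<forall>x\<in>carrier L. \<forall>y\<in>I. x \<otimes>\<^bsub>L\<^esub> y \<in> I)"

text \<open>The analogue of \<^const>\<open>FactRing\<close>.\<close>

definition lie_quotient :: "(complex, 'g) module \<Rightarrow> 'g set \<Rightarrow> (complex, 'g set) module"
  where "lie_quotient L I =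
    \<lparr>carrier = a_rcosets\<^bsub>L\<^esub> I, monoid.mult = rcoset_mult L I, one = I, zero = I, add = set_add L,
     module.smult = (\<lambda>a A. \<Union>x\<in>A. I +>\<^bsub>L\<^esub> (a \<odot>\<^bsub>L\<^esub> x))\<rparr>"

section \<open>Modules over Lie algebras\<close>

text \<open>
  The underlying vector space of a module is a whole type \<open>'m\<close> with scalar multiplication
  \<open>scale\<close>; the action of \<open>L\<close> is \<open>\<rho>\<close>.
\<close>

locale lie_module = L: lie_algebra L + V: vector_space scale
  for L :: "(complex, 'g) module" (structure)
    and scale :: "complex \<Rightarrow> 'm::ab_group_add \<Rightarrow> 'm" +
  fixes \<rho> :: "'g \<Rightarrow> 'm \<Rightarrow> 'm"
  assumes action_linear: "x \<in> carrier L \<Longrightarrow> Vector_Spaces.linear scale scale (\<rho> x)"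
    and action_add: "\<lbrakk>x \<in> carrier L; y \<in> carrier L\<rbrakk> \<Longrightarrow> \<rho> (x \<oplus> y) v = \<rho> x v + \<rho> y v"
    and action_smult: "x \<in> carrier L \<Longrightarrow> \<rho> (a \<odot> x) v = scale a (\<rho> x v)"
    and action_bracket: "\<lbrakk>x \<in> carrier L; y \<in> carrier L\<rbrakk>
      \<Longrightarrow> \<rho> (x \<otimes> y) v = \<rho> x (\<rho> y v) - \<rho> y (\<rho> x v)"

locale simple_lie_module = lie_module L scale \<rho>
  for L :: "(complex, 'g) module" (structure)
    and scale :: "complex \<Rightarrow> 'm::ab_group_add \<Rightarrow> 'm"
    and \<rho> :: "'g \<Rightarrow> 'm \<Rightarrow> 'm" +
  assumes nonzero: "\<exists>v::'m. v \<noteq> 0"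
    and simple: "\<lbrakk>V.subspace W; \<And>x w. \<lbrakk>x \<in> carrier L; w \<in> W\<rbrakk> \<Longrightarrow> \<rho> x w \<in> W\<rbrakk>
      \<Longrightarrow> W = {0} \<or> W = UNIV"

section \<open>Finitely supported functions\<close>

definition pm_scale :: "('s \<Rightarrow> 'b \<Rightarrow> 'b) \<Rightarrow> 's \<Rightarrow> ('a \<Rightarrow>\<^sub>0 'b::zero) \<Rightarrow> ('a \<Rightarrow>\<^sub>0 'b)"
  where "pm_scale scale a p = Poly_Mapping.map (scale a) p"

text \<open>
  The linear extension to the free vector space \<open>'b \<Rightarrow>\<^sub>0 complex\<close> of a function \<open>f\<close> on the
  basis \<open>'b\<close>.
\<close>

definition lin_ext :: "(complex \<Rightarrow> 'v \<Rightarrow> 'v) \<Rightarrow> ('b \<Rightarrow> 'v) \<Rightarrow> ('b \<Rightarrow>\<^sub>0 complex) \<Rightarrow> 'v::ab_group_add"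
  where "lin_ext scale f u =
    (\<Sum>x\<in>Poly_Mapping.keys u. scale (Poly_Mapping.lookup u x) (f x))"

lemma lookup_pm_scale:
  assumes "scale a 0 = 0"
  shows "Poly_Mapping.lookup (pm_scale scale a p) n = scale a (Poly_Mapping.lookup p n)"
  using assms unfolding pm_scale_def by transfer (simp add: when_def)

lemma pm_scale_single:
  assumes "scale a 0 = 0"
  shows "pm_scale scale a (Poly_Mapping.single n v) = Poly_Mapping.single n (scale a v)"
  using assms by (intro poly_mapping_eqI) (simp add: lookup_pm_scale lookup_single when_def)

lemma vector_space_pm_scale:
  assumes "vector_space (scale :: 's::field \<Rightarrow> 'm::ab_group_add \<Rightarrow> 'm)"
  shows "vector_space (pm_scale scale :: 's \<Rightarrow> ('a \<Rightarrow>\<^sub>0 'm) \<Rightarrow> ('a \<Rightarrow>\<^sub>0 'm))"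
proof -
  interpret vector_space scale by (fact assms)
  show ?thesis
    by unfold_locales
      (auto intro!: poly_mapping_eqI simp: lookup_pm_scale lookup_add scale_right_distrib
        scale_left_distrib)
qed

section \<open>The Virasoro algebra\<close>

datatype vir_basis = Vc | Vd int

type_synonym vir = "vir_basis \<Rightarrow>\<^sub>0 complex"

definition vir_c :: vir where "vir_c = Poly_Mapping.single Vc 1"

definition vir_d :: "int \<Rightarrow> vir" where "vir_d i = Poly_Mapping.single (Vd i) 1"

abbreviation vir_scale :: "complex \<Rightarrow> vir \<Rightarrow> vir" where "vir_scale \<equiv> pm_scale (*)"

interpretation vir: vector_space vir_scale
  by (rule vector_space_pm_scale) (unfold_locales, auto simp: algebra_simps)

fun vir_basis_bracket :: "vir_basis \<Rightarrow> vir_basis \<Rightarrow> vir" where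
  "vir_basis_bracket (Vd i) (Vd j) =
     vir_scale (of_int (j - i)) (vir_d (i + j)) +
     (if i = - j then vir_scale ((of_int i ^ 3 - of_int i) / 12) vir_c else 0)"
| "vir_basis_bracket (Vd i) Vc = 0"
| "vir_basis_bracket Vc _ = 0"

definition vir_bracket :: "vir \<Rightarrow> vir \<Rightarrow> vir"
  where "vir_bracket u v =
    lin_ext vir_scale (\<lambda>x. lin_ext vir_scale (\<lambda>y. vir_basis_bracket x y) v) u"

definition virasoro :: "(complex, vir) module"
  where "virasoro =
    \<lparr>carrier = UNIV, monoid.mult = vir_bracket, one = 0, zero = 0, add = (+), module.smult = vir_scale\<rparr>"

definition vir_plus :: "(complex, vir) module"
  where "vir_plus = virasoro\<lparr>carrier := vir.span {vir_d i | i. i \<ge> 0}\<rparr>"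

definition vir_plus_ideal :: "nat \<Rightarrow> vir set"
  where "vir_plus_ideal r = lie_generated virasoro {vir_d i | i. i > int r}"

definition vir_a :: "nat \<Rightarrow> (complex, vir set) module"
  where "vir_a r = lie_quotient vir_plus (vir_plus_ideal r)"

definition d_bar :: "nat \<Rightarrow> nat \<Rightarrow> vir set"
  where "d_bar r i = vir_plus_ideal r +>\<^bsub>vir_plus\<^esub> vir_d (int i)"

section \<open>The modules \<open>N(M,\<beta>)\<close>\<close>

text \<open>
  Laurent polynomials form the group algebra of the integers. The tensor product of \<open>M\<close> with the
  Laurent polynomials is realised by the finitely supported functions from the integers to \<open>M\<close>,
  with \<open>v \<otimes> t\<^sup>n\<close> represented by \<open>Poly_Mapping.single n v\<close>; see \<open>tensor_universal\<close> below.
\<close>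

type_synonym laurent = "int \<Rightarrow>\<^sub>0 complex"

definition tensor :: "(complex \<Rightarrow> 'm \<Rightarrow> 'm) \<Rightarrow> 'm \<Rightarrow> laurent \<Rightarrow> (int \<Rightarrow>\<^sub>0 'm::ab_group_add)"
  where "tensor scale v p = Poly_Mapping.map (\<lambda>a. scale a v) p"

text \<open>Multiplication by \<open>t\<^sup>k\<close>: the component of degree \<open>n\<close> comes from degree \<open>n - k\<close>.\<close>

definition t_shift :: "int \<Rightarrow> (int \<Rightarrow>\<^sub>0 'm::zero) \<Rightarrow> (int \<Rightarrow>\<^sub>0 'm)"
  where "t_shift k w = Poly_Mapping.map_key (\<lambda>n. n - k) w"

definition laurent_act ::
    "(complex \<Rightarrow> 'm \<Rightarrow> 'm) \<Rightarrow> laurent \<Rightarrow> (int \<Rightarrow>\<^sub>0 'm::ab_group_add) \<Rightarrow> (int \<Rightarrow>\<^sub>0 'm)"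
  where "laurent_act scale \<beta> w = lin_ext (pm_scale scale) (\<lambda>k. t_shift k w) \<beta>"

text \<open>
  The operator \<open>d\<^sub>m\<close> on \<open>N(M,0)\<close>, applied to \<open>w\<close> as a sum of its components \<open>v \<otimes> t\<^sup>n\<close>; on pure
  tensors see \<open>N0_d_tensor\<close> below.
\<close>

definition N0_d ::
    "nat \<Rightarrow> (complex \<Rightarrow> 'm \<Rightarrow> 'm) \<Rightarrow> (vir set \<Rightarrow> 'm \<Rightarrow> 'm) \<Rightarrow> int \<Rightarrow>
     (int \<Rightarrow>\<^sub>0 'm::ab_group_add) \<Rightarrow> (int \<Rightarrow>\<^sub>0 'm)"
  where "N0_d r scale \<rho> m w =
    (\<Sum>n\<in>Poly_Mapping.keys w. let v = Poly_Mapping.lookup w n in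
       Poly_Mapping.single (n + m)
         (scale (of_int n) v +
          (\<Sum>i=0..r. scale (of_int m ^ (i + 1) / fact (i + 1)) (\<rho> (d_bar r i) v))))"

text \<open>The twisted action, on the basis of the Virasoro algebra and extended linearly.\<close>

fun N_basis_act ::
    "nat \<Rightarrow> (complex \<Rightarrow> 'm \<Rightarrow> 'm) \<Rightarrow> (vir set \<Rightarrow> 'm \<Rightarrow> 'm) \<Rightarrow> laurent \<Rightarrow> vir_basis \<Rightarrow>
     (int \<Rightarrow>\<^sub>0 'm::ab_group_add) \<Rightarrow> (int \<Rightarrow>\<^sub>0 'm)"
  where
    "N_basis_act r scale \<rho> \<beta> (Vd n) w =
       N0_d r scale \<rho> n w + laurent_act scale (\<beta> * Poly_Mapping.single n 1) w"
  | "N_basis_act r scale \<rho> \<beta> Vc w = 0"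

definition N_act ::
    "nat \<Rightarrow> (complex \<Rightarrow> 'm \<Rightarrow> 'm) \<Rightarrow> (vir set \<Rightarrow> 'm \<Rightarrow> 'm) \<Rightarrow> laurent \<Rightarrow> vir \<Rightarrow>
     (int \<Rightarrow>\<^sub>0 'm::ab_group_add) \<Rightarrow> (int \<Rightarrow>\<^sub>0 'm)"
  where "N_act r scale \<rho> \<beta> u w = lin_ext (pm_scale scale) (\<lambda>x. N_basis_act r scale \<rho> \<beta> x w) u"

section \<open>Consistency of the definitions\<close>

lemma complex_ring_simps [simp]:
  "carrier complex_ring = UNIV" "a \<oplus>\<^bsub>complex_ring\<^esub> b = a + b"
  "a \<otimes>\<^bsub>complex_ring\<^esub> b = a * b" "\<zero>\<^bsub>complex_ring\<^esub> = 0" "\<one>\<^bsub>complex_ring\<^esub> = 1"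
  by (simp_all add: ring_of_type_algebra_def)

lemma lie_algebra_restrict:
  assumes "lie_algebra L" "lie_subalgebra L H"
  shows "lie_algebra (L\<lparr>carrier := H\<rparr>)"
proof -
  interpret lie_algebra L by (fact assms(1))
  interpret H: submodule H complex_ring L using assms(2) by (simp add: lie_subalgebra_def)
  have sub: "x \<in> carrier L" if "x \<in> H" for x using that H.subset by auto
  have "Module.module complex_ring (L\<lparr>carrier := H\<rparr>)"
    by (rule H.submodule_is_module) (rule module_axioms)
  moreover have "lie_algebra_axioms (L\<lparr>carrier := H\<rparr>)"
    using assms(2) sub unfolding lie_subalgebra_def
    by (intro lie_algebra_axioms.intro)
      (auto simp: bracket_add_left bracket_add_right bracket_smult_left bracket_smult_right
        bracket_self jacobi)
  ultimately show ?thesis by (rule lie_algebra.intro)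
qed

lemma lie_algebra_quotient:
  assumes "lie_algebra L" "lie_ideal L I"
  shows "lie_algebra (lie_quotient L I)"
    and "x \<in> carrier L \<Longrightarrow> a \<odot>\<^bsub>lie_quotient L I\<^esub> (I +>\<^bsub>L\<^esub> x) = I +>\<^bsub>L\<^esub> (a \<odot>\<^bsub>L\<^esub> x)"
    and "x \<in> carrier L \<Longrightarrow> y \<in> carrier L \<Longrightarrow>
      (I +>\<^bsub>L\<^esub> x) \<oplus>\<^bsub>lie_quotient L I\<^esub> (I +>\<^bsub>L\<^esub> y) = I +>\<^bsub>L\<^esub> (x \<oplus>\<^bsub>L\<^esub> y)"
    and "x \<in> carrier L \<Longrightarrow> y \<in> carrier L \<Longrightarrow>
      (I +>\<^bsub>L\<^esub> x) \<otimes>\<^bsub>lie_quotient L I\<^esub> (I +>\<^bsub>L\<^esub> y) = I +>\<^bsub>L\<^esub> (x \<otimes>\<^bsub>L\<^esub> y)"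
proof -
  interpret L: lie_algebra L by (fact assms(1))
  interpret I: submodule I complex_ring L using assms(2) by (simp add: lie_ideal_def)
  interpret I: abelian_subgroup I L
    by (rule abelian_subgroupI2) (use L.a_comm_group I.subgroup_axioms in auto)
  let ?Q = "lie_quotient L I"
  have sub: "x \<in> carrier L" if "x \<in> I" for x using that I.subset by auto
  have anti: "y \<otimes>\<^bsub>L\<^esub> x = \<ominus>\<^bsub>L\<^esub> (x \<otimes>\<^bsub>L\<^esub> y)" if x: "x \<in> carrier L" and y: "y \<in> carrier L" for x y
  proof -
    have "\<zero>\<^bsub>L\<^esub> = (x \<oplus>\<^bsub>L\<^esub> y) \<otimes>\<^bsub>L\<^esub> (x \<oplus>\<^bsub>L\<^esub> y)"
      using x y by (simp add: L.bracket_self)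
    also have "\<dots> = y \<otimes>\<^bsub>L\<^esub> x \<oplus>\<^bsub>L\<^esub> x \<otimes>\<^bsub>L\<^esub> y"
      using x y by (simp add: L.a_comm L.bracket_add_left L.bracket_add_right
          L.bracket_self[OF x] L.bracket_self[OF y] L.bracket_closed)
    finally show ?thesis using x y by (metis L.bracket_closed L.minus_equality)
  qed
  have idl: "x \<otimes>\<^bsub>L\<^esub> y \<in> I" if "x \<in> carrier L" "y \<in> I" for x y
    using assms(2) that by (auto simp: lie_ideal_def)
  have idr: "y \<otimes>\<^bsub>L\<^esub> x \<in> I" if "x \<in> carrier L" "y \<in> I" for x y
    using anti[OF that(1) sub[OF that(2)]] idl[OF that] by simp
  have eqI: "I +>\<^bsub>L\<^esub> (h \<oplus>\<^bsub>L\<^esub> x) = I +>\<^bsub>L\<^esub> x" if "h \<in> I" "x \<in> carrier L" for h x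
    using L.a_coset_add_assoc[OF I.a_subset sub[OF that(1)] that(2)]
      L.a_coset_join2[OF sub[OF that(1)] I.a_subgroup that(1)] by simp
  have mem: "z \<in> I +>\<^bsub>L\<^esub> x \<longleftrightarrow> (\<exists>h\<in>I. z = h \<oplus>\<^bsub>L\<^esub> x)" for z x
    by (auto simp: a_r_coset_def')
  have UN_eq: "(\<Union>y\<in>A. f y) = c" if "z \<in> A" "\<And>y. y \<in> A \<Longrightarrow> f y = c"
    for A :: "'a set" and f c z using that by auto
  show sm: "a \<odot>\<^bsub>?Q\<^esub> (I +>\<^bsub>L\<^esub> x) = I +>\<^bsub>L\<^esub> (a \<odot>\<^bsub>L\<^esub> x)" if x: "x \<in> carrier L" for a x
  proof -
    have "I +>\<^bsub>L\<^esub> (a \<odot>\<^bsub>L\<^esub> y) = I +>\<^bsub>L\<^esub> (a \<odot>\<^bsub>L\<^esub> x)" if "y \<in> I +>\<^bsub>L\<^esub> x" for y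
      using that x by (auto simp: mem sub L.smult_r_distr eqI I.smult_closed)
    then have "(\<Union>y\<in>I +>\<^bsub>L\<^esub> x. I +>\<^bsub>L\<^esub> (a \<odot>\<^bsub>L\<^esub> y)) = I +>\<^bsub>L\<^esub> (a \<odot>\<^bsub>L\<^esub> x)"
      by (rule UN_eq[OF I.a_rcos_self[OF x]])
    then show ?thesis by (simp add: lie_quotient_def)
  qed
  show ad: "(I +>\<^bsub>L\<^esub> x) \<oplus>\<^bsub>?Q\<^esub> (I +>\<^bsub>L\<^esub> y) = I +>\<^bsub>L\<^esub> (x \<oplus>\<^bsub>L\<^esub> y)"
    if "x \<in> carrier L" "y \<in> carrier L" for x y
    using that by (simp add: lie_quotient_def I.a_rcos_sum)
  show br: "(I +>\<^bsub>L\<^esub> x) \<otimes>\<^bsub>?Q\<^esub> (I +>\<^bsub>L\<^esub> y) = I +>\<^bsub>L\<^esub> (x \<otimes>\<^bsub>L\<^esub> y)"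
    if x: "x \<in> carrier L" and y: "y \<in> carrier L" for x y
  proof -
    have "I +>\<^bsub>L\<^esub> (a \<otimes>\<^bsub>L\<^esub> b) = I +>\<^bsub>L\<^esub> (x \<otimes>\<^bsub>L\<^esub> y)"
      if "a \<in> I +>\<^bsub>L\<^esub> x" "b \<in> I +>\<^bsub>L\<^esub> y" for a b
    proof -
      from that obtain h k where *: "h \<in> I" "k \<in> I" "a = h \<oplus>\<^bsub>L\<^esub> x" "b = k \<oplus>\<^bsub>L\<^esub> y"
        by (auto simp: mem)
      have "a \<otimes>\<^bsub>L\<^esub> b = h \<otimes>\<^bsub>L\<^esub> (k \<oplus>\<^bsub>L\<^esub> y) \<oplus>\<^bsub>L\<^esub> (x \<otimes>\<^bsub>L\<^esub> k \<oplus>\<^bsub>L\<^esub> x \<otimes>\<^bsub>L\<^esub> y)"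
        using * x y sub
        by (simp add: L.bracket_add_left[of h x "k \<oplus>\<^bsub>L\<^esub> y"] L.bracket_add_right[of x k y])
      moreover have "h \<otimes>\<^bsub>L\<^esub> (k \<oplus>\<^bsub>L\<^esub> y) \<in> I" "x \<otimes>\<^bsub>L\<^esub> k \<in> I"
        using * x y sub idl idr by auto
      ultimately show ?thesis using x y by (simp add: eqI L.bracket_closed sub)
    qed
    then have "(\<Union>a\<in>I +>\<^bsub>L\<^esub> x. \<Union>b\<in>I +>\<^bsub>L\<^esub> y. I +>\<^bsub>L\<^esub> (a \<otimes>\<^bsub>L\<^esub> b)) = I +>\<^bsub>L\<^esub> (x \<otimes>\<^bsub>L\<^esub> y)"
      by (intro UN_eq[OF I.a_rcos_self[OF x]] UN_eq[OF I.a_rcos_self[OF y]])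
    then show ?thesis by (simp add: lie_quotient_def rcoset_mult_def)
  qed
  have carr: "carrier ?Q = (\<lambda>x. I +>\<^bsub>L\<^esub> x) ` carrier L"
    by (auto simp: lie_quotient_def A_RCOSETS_def')
  have zero: "\<zero>\<^bsub>?Q\<^esub> = I +>\<^bsub>L\<^esub> \<zero>\<^bsub>L\<^esub>"
    by (simp add: lie_quotient_def I.a_subset L.a_coset_add_zero)
  have ag: "abelian_group ?Q"
  proof (rule abelian_groupI)
    fix A assume "A \<in> carrier ?Q"
    then obtain x where x: "x \<in> carrier L" "A = I +>\<^bsub>L\<^esub> x" by (auto simp: carr)
    then have "(I +>\<^bsub>L\<^esub> (\<ominus>\<^bsub>L\<^esub> x)) \<oplus>\<^bsub>?Q\<^esub> A = \<zero>\<^bsub>?Q\<^esub>" by (simp add: ad zero L.l_neg)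
    with x show "\<exists>B\<in>carrier ?Q. B \<oplus>\<^bsub>?Q\<^esub> A = \<zero>\<^bsub>?Q\<^esub>" by (auto simp: carr)
  qed (auto simp: carr ad zero L.a_ac)
  note simps = sm ad br zero L.smult_l_distr L.smult_r_distr L.smult_assoc1
    L.bracket_add_left L.bracket_add_right L.bracket_smult_left L.bracket_smult_right
    L.bracket_self L.jacobi L.bracket_closed
  have "Module.module complex_ring ?Q"
    by (rule moduleI[OF L.R.is_cring ag])
      (auto simp: carr simps L.smult_l_distr[simplified] L.smult_assoc1[simplified] L.smult_one[simplified])
  moreover have "lie_algebra_axioms ?Q"
    by (rule lie_algebra_axioms.intro) (auto simp: carr simps)
  ultimately show "lie_algebra ?Q" by (rule lie_algebra.intro)
qed

lemma lin_ext_superset: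
  assumes "vector_space scale" "finite S" "Poly_Mapping.keys u \<subseteq> S"
  shows "lin_ext scale f u = (\<Sum>x\<in>S. scale (Poly_Mapping.lookup u x) (f x))"
proof -
  interpret vector_space scale by (fact assms(1))
  show ?thesis unfolding lin_ext_def using assms(2,3)
    by (intro sum.mono_neutral_left) (auto simp: in_keys_iff)
qed

lemma lin_ext_single: "vector_space scale \<Longrightarrow> lin_ext scale f (Poly_Mapping.single x a) = scale a (f x)"
  by (subst lin_ext_superset[where S = "{x}"]) auto

lemma linear_lin_ext:
  fixes f :: "'a \<Rightarrow> 'v::ab_group_add"
  assumes "vector_space scale"
  shows "Vector_Spaces.linear (pm_scale (*)) scale (lin_ext scale f)"
proof -
  interpret vector_space scale by (fact assms)
  interpret P: vector_space "pm_scale (*) :: complex \<Rightarrow> ('a \<Rightarrow>\<^sub>0 complex) \<Rightarrow> _"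
    by (rule vector_space_pm_scale) (unfold_locales, auto simp: algebra_simps)
  show ?thesis unfolding Vector_Spaces.linear_iff
  proof (intro conjI allI vector_space_axioms P.vector_space_axioms)
    fix u v :: "'a \<Rightarrow>\<^sub>0 complex" and a
    let ?S = "Poly_Mapping.keys u \<union> Poly_Mapping.keys v"
    have "Poly_Mapping.keys (u + v) \<subseteq> ?S" by (rule keys_add)
    then show "lin_ext scale f (u + v) = lin_ext scale f u + lin_ext scale f v"
      by (simp add: lin_ext_superset[OF assms, where S = ?S] lookup_add scale_left_distrib
          sum.distrib)
    have "Poly_Mapping.keys (pm_scale (*) a u) \<subseteq> Poly_Mapping.keys u"
      by (auto simp: in_keys_iff lookup_pm_scale)
    then show "lin_ext scale f (pm_scale (*) a u) = scale a (lin_ext scale f u)"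
      by (simp add: lin_ext_superset[OF assms, where S = "Poly_Mapping.keys u"] lookup_pm_scale
          scale_sum_right)
  qed
qed

lemma linear_lin_ext_fun:
  assumes "vector_space scale" "\<And>x. Vector_Spaces.linear s scale (F x)"
  shows "Vector_Spaces.linear s scale (\<lambda>v. lin_ext scale (\<lambda>x. F x v) u)"
proof -
  interpret vector_space scale by (fact assms)
  show ?thesis using assms(2) unfolding lin_ext_def Vector_Spaces.linear_iff
    by (auto simp: scale_right_distrib sum.distrib scale_sum_right mult.commute)
qed

lemma vir_span_basis: "vir.span (range (\<lambda>x. Poly_Mapping.single x 1)) = UNIV"
proof -
  have "u \<in> vir.span (range (\<lambda>x. Poly_Mapping.single x 1))" for u :: vir
  proof -
    have "u = (\<Sum>x\<in>Poly_Mapping.keys u. vir_scale (Poly_Mapping.lookup u x) (Poly_Mapping.single x 1))"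
      by (rule poly_mapping_eqI)
        (simp add: lookup_sum lookup_pm_scale lookup_single when_def in_keys_iff
          if_distrib[of "\<lambda>z. _ * z"] cong: if_cong)
    also have "\<dots> \<in> vir.span (range (\<lambda>x. Poly_Mapping.single x 1))"
      by (intro vir.span_sum vir.span_scale vir.span_base) auto
    finally show ?thesis .
  qed
  then show ?thesis by auto
qed

lemma vir_bracket_linear:
  "Vector_Spaces.linear vir_scale vir_scale (\<lambda>u. vir_bracket u v)"
  "Vector_Spaces.linear vir_scale vir_scale (vir_bracket u)"
  unfolding vir_bracket_def
  using linear_lin_ext[OF vir.vector_space_axioms, of "\<lambda>x. lin_ext vir_scale (vir_basis_bracket x) v"]
    linear_lin_ext_fun[OF vir.vector_space_axioms linear_lin_ext[OF vir.vector_space_axioms],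
      of vir_basis_bracket u]
  by (simp_all add: vir_bracket_def[abs_def])

lemma vir_bracket_basis:
  "vir_bracket (Poly_Mapping.single x 1) (Poly_Mapping.single y 1) = vir_basis_bracket x y"
  unfolding vir_bracket_def by (simp add: lin_ext_single[OF vir.vector_space_axioms])

lemma lookup_vir_d: "Poly_Mapping.lookup (vir_d i) x = (if x = Vd i then 1 else 0)"
  by (simp add: vir_d_def lookup_single when_def)

lemma vir_brackets:
  "vir_bracket (vir_d i) (vir_d j) = vir_scale (of_int (j - i)) (vir_d (i + j)) +
     (if i = - j then vir_scale ((of_int i ^ 3 - of_int i) / 12) vir_c else 0)"
  "vir_bracket (vir_d i) vir_c = 0" "vir_bracket vir_c (vir_d i) = 0" "vir_bracket vir_c vir_c = 0"
  unfolding vir_d_def vir_c_def vir_bracket_basis by (simp_all add: vir_d_def vir_c_def)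

lemma vir_linear_eq_0:
  assumes "Vector_Spaces.linear vir_scale vir_scale f" "\<And>x. f (Poly_Mapping.single x 1) = 0"
  shows "f u = 0"
proof -
  interpret Vector_Spaces.linear vir_scale vir_scale f by (fact assms(1))
  have "u \<in> vir.span (range (\<lambda>x. Poly_Mapping.single x 1))" by (simp add: vir_span_basis)
  then show ?thesis by (rule eq_0_on_span[rotated]) (auto simp: assms(2))
qed

lemma vir_bracket_simps:
  "vir_bracket (u + v) w = vir_bracket u w + vir_bracket v w"
  "vir_bracket w (u + v) = vir_bracket w u + vir_bracket w v"
  "vir_bracket (vir_scale a u) w = vir_scale a (vir_bracket u w)"
  "vir_bracket w (vir_scale a u) = vir_scale a (vir_bracket w u)"
  "vir_bracket 0 w = 0" "vir_bracket w 0 = 0"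
proof -
  interpret l: Vector_Spaces.linear vir_scale vir_scale "\<lambda>u. vir_bracket u w" by (rule vir_bracket_linear)
  interpret r: Vector_Spaces.linear vir_scale vir_scale "vir_bracket w" by (rule vir_bracket_linear)
  show "vir_bracket (u + v) w = vir_bracket u w + vir_bracket v w"
    "vir_bracket w (u + v) = vir_bracket w u + vir_bracket w v"
    "vir_bracket (vir_scale a u) w = vir_scale a (vir_bracket u w)"
    "vir_bracket w (vir_scale a u) = vir_scale a (vir_bracket w u)"
    "vir_bracket 0 w = 0" "vir_bracket w 0 = 0"
    by (fact l.add r.add l.scale r.scale l.zero r.zero)+
qed

lemma vir_bracket_anti: "vir_bracket u v = - vir_bracket v u"
proof -
  have basis: "vir_basis_bracket x y + vir_basis_bracket y x = 0" for x y
    by (cases x; cases y) (auto intro!: poly_mapping_eqI simp: lookup_add lookup_pm_scale vir_d_def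
        vir_c_def lookup_single when_def field_simps)
  have 1: "vir_bracket u (Poly_Mapping.single y 1) + vir_bracket (Poly_Mapping.single y 1) u = 0" for u y
    by (rule vir_linear_eq_0[of "\<lambda>u. vir_bracket u (Poly_Mapping.single y 1) + vir_bracket (Poly_Mapping.single y 1) u"])
      (auto simp: Vector_Spaces.linear_iff vir.vector_space_axioms vir_bracket_simps vir_bracket_basis
        basis vir.scale_right_distrib)
  have "vir_bracket u v + vir_bracket v u = 0"
    by (rule vir_linear_eq_0[of "\<lambda>v. vir_bracket u v + vir_bracket v u"])
      (auto simp: Vector_Spaces.linear_iff vir.vector_space_axioms vir_bracket_simps 1
        vir.scale_right_distrib)
  then show ?thesis by (simp add: eq_neg_iff_add_eq_0)
qed

lemma vir_bracket_self: "vir_bracket u u = 0"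
proof (rule poly_mapping_eqI)
  fix n
  have "Poly_Mapping.lookup (vir_bracket u u) n = - Poly_Mapping.lookup (vir_bracket u u) n"
    using vir_bracket_anti[of u u] by (metis lookup_uminus)
  then show "Poly_Mapping.lookup (vir_bracket u u) n = Poly_Mapping.lookup 0 n" by simp
qed

lemma vir_bracket_central: "vir_bracket u vir_c = 0" "vir_bracket vir_c u = 0"
proof -
  have "vir_bracket (Poly_Mapping.single x 1) vir_c = 0" for x
    by (cases x) (simp_all add: vir_c_def vir_bracket_basis)
  then show "vir_bracket u vir_c = 0" by (rule vir_linear_eq_0[OF vir_bracket_linear(1)])
  then show "vir_bracket vir_c u = 0" by (simp add: vir_bracket_anti[of vir_c u])
qed

lemma vir_jacobi:
  "vir_bracket u (vir_bracket v w) + vir_bracket v (vir_bracket w u) +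
   vir_bracket w (vir_bracket u v) = 0" (is "?J u v w = 0")
proof -
  have lin: "Vector_Spaces.linear vir_scale vir_scale (\<lambda>u. ?J u v w)" for v w
    by (auto simp: Vector_Spaces.linear_iff vir.vector_space_axioms vir_bracket_simps
        vir.scale_right_distrib)
  have cyc: "?J u v w = ?J v w u" for u v w by (simp add: add_ac)
  have two: "vir_bracket (vir_d i) (vir_bracket (vir_d j) (vir_d k)) =
      vir_scale (of_int (k - j) * of_int (j + k - i)) (vir_d (i + j + k)) +
      (if i + j + k = 0 then vir_scale (of_int (k - j) * (of_int i ^ 3 - of_int i) / 12) vir_c else 0)"
    for i j k
  proof -
    have "i = - (j + k) \<longleftrightarrow> i + j + k = 0" by auto
    then show ?thesis
      by (simp add: vir_brackets vir_bracket_simps vir.scale_right_distrib add.assoc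
          del: of_int_diff of_int_add minus_add_distrib)
  qed
  have ddd: "?J (vir_d i) (vir_d j) (vir_d k) = 0" for i j k
  proof -
    have perm: "j + k + i = i + j + k" "k + i + j = i + j + k" by auto
    show ?thesis unfolding two perm
    proof (rule poly_mapping_eqI, cases "i + j + k = 0")
      fix n assume "i + j + k = 0"
      then have k: "k = - i - j" by simp
      show "Poly_Mapping.lookup (vir_scale (of_int (k - j) * of_int (j + k - i)) (vir_d (i + j + k)) +
         (if i + j + k = 0 then vir_scale (of_int (k - j) * (of_int i ^ 3 - of_int i) / 12) vir_c else 0) +
         (vir_scale (of_int (i - k) * of_int (k + i - j)) (vir_d (i + j + k)) +
         (if i + j + k = 0 then vir_scale (of_int (i - k) * (of_int j ^ 3 - of_int j) / 12) vir_c else 0)) +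
         (vir_scale (of_int (j - i) * of_int (i + j - k)) (vir_d (i + j + k)) +
         (if i + j + k = 0 then vir_scale (of_int (j - i) * (of_int k ^ 3 - of_int k) / 12) vir_c else 0))) n =
         Poly_Mapping.lookup 0 n"
        unfolding k by (simp add: lookup_add lookup_pm_scale lookup_vir_d vir_c_def lookup_single when_def
          field_simps power3_eq_cube)
    qed (simp add: lookup_add lookup_pm_scale lookup_vir_d, simp add: algebra_simps)
  qed
  have basis: "?J (Poly_Mapping.single x 1) (Poly_Mapping.single y 1) (Poly_Mapping.single z 1) = 0"
    for x y z
    using ddd
    by (cases x; cases y; cases z)
      (simp_all add: vir_d_def[symmetric] vir_c_def[symmetric] vir_bracket_central
        vir_bracket_simps del: vir_brackets)
  have 1: "?J u (Poly_Mapping.single y 1) (Poly_Mapping.single z 1) = 0" for u y z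
    using basis by (rule vir_linear_eq_0[OF lin])
  have 2: "?J u v (Poly_Mapping.single z 1) = 0" for u v z
    unfolding cyc[of u] by (rule vir_linear_eq_0[OF lin]) (metis 1 cyc)
  show ?thesis
    unfolding cyc[of u] cyc[of v] by (rule vir_linear_eq_0[OF lin]) (metis 2 cyc)
qed

lemma virasoro_simps [simp]:
  "carrier virasoro = UNIV" "x \<oplus>\<^bsub>virasoro\<^esub> y = x + y" "\<zero>\<^bsub>virasoro\<^esub> = 0"
  "x \<otimes>\<^bsub>virasoro\<^esub> y = vir_bracket x y" "a \<odot>\<^bsub>virasoro\<^esub> x = vir_scale a x"
  by (simp_all add: virasoro_def)

lemma lie_algebra_virasoro: "lie_algebra virasoro"
proof -
  have ag: "abelian_group virasoro"
    by (rule abelian_groupI) (auto simp: add_ac intro: exI[of _ "- x" for x])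
  have cr: "cring complex_ring" by (rule cring_from_type_algebra)
  have "Module.module complex_ring virasoro"
    by (rule moduleI[OF cr ag]) (auto simp: vir.scale_left_distrib vir.scale_right_distrib)
  moreover have "lie_algebra_axioms virasoro"
    by (rule lie_algebra_axioms.intro)
      (auto simp: vir_bracket_simps vir_bracket_self vir_jacobi)
  ultimately show ?thesis by (rule lie_algebra.intro)
qed

lemma submodule_virasoro: "submodule H complex_ring virasoro \<longleftrightarrow> vir.subspace H"
proof -
  interpret lie_algebra virasoro by (rule lie_algebra_virasoro)
  have neg: "\<ominus>\<^bsub>virasoro\<^esub> x = vir_scale (- 1) x" for x
    by (rule minus_equality) auto
  show ?thesis
  proof
    assume "vir.subspace H"
    then show "submodule H complex_ring virasoro"
      by (intro submoduleI) (auto simp: neg vir.subspace_def simp del: vir.scale_minus_left)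
  next
    assume H: "submodule H complex_ring virasoro"
    interpret H: submodule H complex_ring virasoro by (rule H)
    show "vir.subspace H"
      using submoduleE[OF H] H.one_closed by (auto simp: vir.subspace_def)
  qed
qed

lemma bracket_span:
  assumes "0 \<le> k" "0 \<le> l" "u \<in> vir.span {vir_d i | i. i \<ge> k}" "v \<in> vir.span {vir_d i | i. i \<ge> l}"
  shows "vir_bracket u v \<in> vir.span {vir_d i | i. i \<ge> k + l}"
proof -
  have 1: "vir_bracket (vir_d i) (vir_d j) \<in> vir.span {vir_d i | i. i \<ge> k + l}"
    if "i \<ge> k" "j \<ge> l" for i j
  proof -
    have "i = 0" if "i = - j" using that \<open>i \<ge> k\<close> \<open>j \<ge> l\<close> assms by auto
    then have "vir_bracket (vir_d i) (vir_d j) = vir_scale (of_int (j - i)) (vir_d (i + j))"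
      by (auto simp: vir_brackets)
    moreover have "vir_d (i + j) \<in> {vir_d i | i. i \<ge> k + l}"
      using that by (intro CollectI exI[of _ "i + j"]) auto
    ultimately show ?thesis by (simp only: vir.span_scale vir.span_base)
  qed
  have sub: "vir.subspace {u. vir_bracket u v \<in> vir.span S}" "vir.subspace {v. vir_bracket u v \<in> vir.span S}"
    for u v S
    by (auto simp: vir.subspace_def vir_bracket_simps vir.span_zero vir.span_add vir.span_scale)
  have 2: "vir_bracket u (vir_d j) \<in> vir.span {vir_d i | i. i \<ge> k + l}" if "j \<ge> l" for j
    using vir.span_induct[OF assms(3) sub(1)[of "vir_d j"]] that 1 by blast
  show ?thesis
    using vir.span_induct[OF assms(4) sub(2)[of u]] 2 by blast
qed

lemma vir_plus_ideal_eq: "vir_plus_ideal r = vir.span {vir_d i | i. i > int r}"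
proof
  have *: "{vir_d i | i. i > int r} = {vir_d i | i. i \<ge> int r + 1}" by auto
  have "lie_subalgebra virasoro (vir.span {vir_d i | i. i > int r})"
    unfolding lie_subalgebra_def submodule_virasoro
  proof (intro conjI ballI vir.subspace_span)
    fix x y assume "x \<in> vir.span {vir_d i | i. i > int r}" "y \<in> vir.span {vir_d i | i. i > int r}"
    then have "vir_bracket x y \<in> vir.span {vir_d i | i. i \<ge> (int r + 1) + (int r + 1)}"
      unfolding * by (intro bracket_span) auto
    also have "\<dots> \<subseteq> vir.span {vir_d i | i. i > int r}" by (rule vir.span_mono) auto
    finally show "x \<otimes>\<^bsub>virasoro\<^esub> y \<in> vir.span {vir_d i | i. i > int r}" by simp
  qed
  then show "vir_plus_ideal r \<subseteq> vir.span {vir_d i | i. i > int r}"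
    unfolding vir_plus_ideal_def lie_generated_def by (intro hull_minimal vir.span_superset)
  show "vir.span {vir_d i | i. i > int r} \<subseteq> vir_plus_ideal r"
    unfolding vir_plus_ideal_def lie_generated_def hull_def
    by (auto simp: lie_subalgebra_def submodule_virasoro dest: vir.span_minimal)
qed

lemma lie_algebra_vir_plus: "lie_algebra vir_plus"
  unfolding vir_plus_def
proof (rule lie_algebra_restrict[OF lie_algebra_virasoro])
  show "lie_subalgebra virasoro (vir.span {vir_d i | i. i \<ge> 0})"
    unfolding lie_subalgebra_def submodule_virasoro
    using bracket_span[of 0 0] by (auto intro: vir.subspace_span)
qed

lemma lie_ideal_vir_plus_ideal: "lie_ideal vir_plus (vir_plus_ideal r)"
proof -
  interpret lie_algebra vir_plus by (rule lie_algebra_vir_plus)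
  have eq: "{vir_d i | i. i > int r} = {vir_d i | i. i \<ge> int r + 1}" by auto
  have neg: "\<ominus>\<^bsub>vir_plus\<^esub> x = vir_scale (- 1) x" if "x \<in> carrier vir_plus" for x
    using that vir.scale_minus_left[of 1 x] by (intro minus_equality)
      (auto simp: vir_plus_def intro: vir.span_neg)
  have sub: "vir_plus_ideal r \<subseteq> carrier vir_plus"
    using vir.span_mono[of "{vir_d i | i. i > int r}" "{vir_d i | i. i \<ge> 0}"]
    by (force simp: vir_plus_ideal_eq vir_plus_def)
  have "submodule (vir_plus_ideal r) complex_ring vir_plus"
    using sub by (intro submoduleI)
      (auto simp: neg subset_iff, auto simp: vir_plus_def vir_plus_ideal_eq vir.span_zero
        vir.span_add vir.span_scale vir.span_neg)
  moreover have "x \<otimes>\<^bsub>vir_plus\<^esub> y \<in> vir_plus_ideal r"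
    if "x \<in> carrier vir_plus" "y \<in> vir_plus_ideal r" for x y
    using that bracket_span[of 0 "int r + 1" x y]
    by (auto simp: vir_plus_def vir_plus_ideal_eq eq)
  ultimately show ?thesis by (auto simp: lie_ideal_def)
qed

lemma lie_algebra_vir_a: "lie_algebra (vir_a r)"
  unfolding vir_a_def
  by (rule lie_algebra_quotient(1)[OF lie_algebra_vir_plus lie_ideal_vir_plus_ideal])

lemma vir_d_bar_mem: "d_bar r i \<in> carrier (vir_a r)"
proof -
  have "vir_d (int i) \<in> carrier vir_plus" by (auto simp: vir_plus_def intro!: vir.span_base)
  then show ?thesis by (auto simp: d_bar_def vir_a_def lie_quotient_def A_RCOSETS_def')
qed

lemma N0_d_tensor:
  assumes "lie_module (vir_a r) scale \<rho>"
  shows "N0_d r scale \<rho> m (tensor scale v (Poly_Mapping.single n 1)) =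
    tensor scale (scale (of_int n) v +
      (\<Sum>i=0..r. scale (of_int m ^ (i + 1) / fact (i + 1)) (\<rho> (d_bar r i) v)))
      (Poly_Mapping.single (n + m) 1)"
proof -
  interpret lie_module "vir_a r" scale \<rho> by (fact assms)
  have "\<rho> (d_bar r i) 0 = 0" for i
  proof -
    interpret Vector_Spaces.linear scale scale "\<rho> (d_bar r i)"
      by (rule action_linear[OF vir_d_bar_mem])
    show ?thesis by (rule zero)
  qed
  then show ?thesis
    by (cases "v = 0") (simp_all add: N0_d_def tensor_def Let_def)
qed

lemma laurent_act_tensor:
  assumes "vector_space scale"
  shows "laurent_act scale (Poly_Mapping.single k 1) (tensor scale v (Poly_Mapping.single n 1)) =
    tensor scale v (Poly_Mapping.single (n + k) 1)"
proof -
  interpret vector_space scale by (fact assms)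
  have "inj (\<lambda>j::int. j - k)" by (auto simp: inj_def)
  then show ?thesis
    using map_key_single[of "\<lambda>j. j - k" "n + k" v]
    by (simp add: laurent_act_def lin_ext_single vector_space_pm_scale assms tensor_def t_shift_def
        pm_scale_single)
qed

lemma N_act_generators:
  assumes "vector_space scale"
  shows "N_act r scale \<rho> \<beta> (vir_d n) w =
      N0_d r scale \<rho> n w + laurent_act scale (\<beta> * Poly_Mapping.single n 1) w"
    and "N_act r scale \<rho> \<beta> vir_c w = 0"
proof -
  interpret vector_space "pm_scale scale :: _ \<Rightarrow> (int \<Rightarrow>\<^sub>0 'a) \<Rightarrow> _"
    by (rule vector_space_pm_scale) (rule assms)
  show "N_act r scale \<rho> \<beta> (vir_d n) w =
      N0_d r scale \<rho> n w + laurent_act scale (\<beta> * Poly_Mapping.single n 1) w"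
    "N_act r scale \<rho> \<beta> vir_c w = 0"
    by (simp_all add: N_act_def vir_d_def vir_c_def lin_ext_single vector_space_axioms)
qed

lemma tensor_universal:
  fixes scale :: "complex \<Rightarrow> 'm::ab_group_add \<Rightarrow> 'm" and s :: "complex \<Rightarrow> 'w::ab_group_add \<Rightarrow> 'w"
    and B :: "'m \<Rightarrow> laurent \<Rightarrow> 'w"
  assumes "vector_space scale" "vector_space s"
    and "\<And>p. Vector_Spaces.linear scale s (\<lambda>v. B v p)"
    and "\<And>v. Vector_Spaces.linear (pm_scale (*)) s (B v)"
  shows "\<exists>!f. Vector_Spaces.linear (pm_scale scale) s f \<and> (\<forall>v p. f (tensor scale v p) = B v p)"
proof -
  interpret M: vector_space scale by (fact assms(1))
  interpret W: vector_space s by (fact assms(2))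
  interpret T: vector_space "pm_scale scale :: _ \<Rightarrow> (int \<Rightarrow>\<^sub>0 'm) \<Rightarrow> _"
    by (rule vector_space_pm_scale) (rule assms)
  have B: "B (u + v) p = B u p + B v p" "B (scale a v) p = s a (B v p)" "B v (p + q) = B v p + B v q"
    "B v (pm_scale (*) a p) = s a (B v p)" "B 0 p = 0" "B v 0 = 0" for u v p q a
    using assms(3,4) unfolding Vector_Spaces.linear_iff by (metis add_cancel_right_left)+
  have lookup_tensor: "Poly_Mapping.lookup (tensor scale v p) n = scale (Poly_Mapping.lookup p n) v"
    for v p n
    unfolding tensor_def by (simp add: Poly_Mapping.map.rep_eq when_def)
  define t where "t n = (Poly_Mapping.single n 1 :: laurent)" for n
  define f where "f w = (\<Sum>n\<in>Poly_Mapping.keys w. B (Poly_Mapping.lookup w n) (t n))" for w :: "int \<Rightarrow>\<^sub>0 'm"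
  have f: "f w = (\<Sum>n\<in>S. B (Poly_Mapping.lookup w n) (t n))"
    if "finite S" "Poly_Mapping.keys w \<subseteq> S" for w S
    unfolding f_def using that by (intro sum.mono_neutral_left) (auto simp: in_keys_iff B)
  have lin: "Vector_Spaces.linear (pm_scale scale) s f"
    unfolding Vector_Spaces.linear_iff
  proof (intro conjI allI T.vector_space_axioms W.vector_space_axioms)
    fix u v :: "int \<Rightarrow>\<^sub>0 'm" and a
    let ?S = "Poly_Mapping.keys u \<union> Poly_Mapping.keys v"
    have "Poly_Mapping.keys (u + v) \<subseteq> ?S" by (rule keys_add)
    then show "f (u + v) = f u + f v"
      by (simp add: f[where S = ?S] lookup_add B sum.distrib)
    have "Poly_Mapping.keys (pm_scale scale a u) \<subseteq> Poly_Mapping.keys u"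
      by (auto simp: in_keys_iff lookup_pm_scale)
    then show "f (pm_scale scale a u) = s a (f u)"
      by (simp add: f[where S = "Poly_Mapping.keys u"] lookup_pm_scale B W.scale_sum_right)
  qed
  have decomp: "w = (\<Sum>n\<in>Poly_Mapping.keys w. tensor scale (Poly_Mapping.lookup w n) (t n))" for w
    by (rule poly_mapping_eqI)
      (simp add: lookup_sum lookup_tensor t_def lookup_single when_def in_keys_iff
        if_distrib[of "\<lambda>a. scale a _"] cong: if_cong)
  have single: "p = (\<Sum>n\<in>Poly_Mapping.keys p. pm_scale (*) (Poly_Mapping.lookup p n) (t n))" for p :: laurent
    by (rule poly_mapping_eqI)
      (simp add: lookup_sum lookup_pm_scale t_def lookup_single when_def in_keys_iff
        if_distrib[of "\<lambda>a. _ * a"] cong: if_cong)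
  have Bsum: "B v (\<Sum>n\<in>S. g n) = (\<Sum>n\<in>S. B v (g n))" for v g and S :: "int set"
    by (induction S rule: infinite_finite_induct) (auto simp: B)
  have fB: "f (tensor scale v p) = B v p" for v p
  proof -
    have "Poly_Mapping.keys (tensor scale v p) \<subseteq> Poly_Mapping.keys p"
      by (auto simp: in_keys_iff lookup_tensor)
    then have "f (tensor scale v p) = (\<Sum>n\<in>Poly_Mapping.keys p. s (Poly_Mapping.lookup p n) (B v (t n)))"
      by (simp add: f[where S = "Poly_Mapping.keys p"] lookup_tensor B)
    also have "\<dots> = B v (\<Sum>n\<in>Poly_Mapping.keys p. pm_scale (*) (Poly_Mapping.lookup p n) (t n))"
      by (simp add: Bsum B)
    finally show ?thesis using single[of p] by simp
  qed
  show ?thesis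
  proof (rule ex1I[of _ f])
    show "Vector_Spaces.linear (pm_scale scale) s f \<and> (\<forall>v p. f (tensor scale v p) = B v p)"
      using lin fB by blast
  next
    fix g assume g: "Vector_Spaces.linear (pm_scale scale) s g \<and> (\<forall>v p. g (tensor scale v p) = B v p)"
    interpret g: Vector_Spaces.linear "pm_scale scale" s g using g by blast
    show "g = f"
    proof
      fix w
      have "g w = (\<Sum>n\<in>Poly_Mapping.keys w. g (tensor scale (Poly_Mapping.lookup w n) (t n)))"
        by (subst decomp[of w]) (rule g.sum)
      then show "g w = f w" using g by (simp add: f_def)
    qed
  qed
qed

end

theory Submission
  imports Defs
begin

text \<open>
  Write \<open>D\<^sub>i\<close> for the action of \<open>d_bar r i\<close> on \<open>M\<close>, extended degreewise to
  \<open>M \<otimes> \<complex>[t, t\<^sup>-\<^sup>1]\<close>, and \<open>\<partial>\<close> for the operator that multiplies the component of degree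
  \<open>n\<close> by \<open>n\<close>. Put \<open>R\<^sub>0 = \<partial> + \<beta>\<close>, \<open>R\<^sub>i\<^sub>+\<^sub>1 = D\<^sub>i\<close> and \<open>s = r + 1\<close>. Then \<open>d\<^sub>m\<close> acts
  on \<open>N(M,\<beta>)\<close> as \<open>T\<^sub>m = t\<^sup>m F\<^sub>m\<close>, where \<open>F\<^sub>m = \<Sum>\<^sub>i\<^sub>\<le>\<^sub>s m\<^sup>i/i! R\<^sub>i\<close> is a polynomial in
  \<open>m\<close>. The Laurent polynomial \<open>\<beta>\<close> is absorbed into \<open>R\<^sub>0\<close>: since multiplication by \<open>\<beta>\<close>
  commutes with all \<open>t\<^sup>k\<close> and all \<open>D\<^sub>i\<close>, the operators \<open>t\<^sup>k\<close> and \<open>R\<^sub>i\<close> satisfy the relations that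
  hold for \<open>\<beta> = 0\<close>, and the locale \<open>exponential_witt\<close> records just these relations. They
  imply the Witt relations for the \<open>T\<^sub>m\<close> (\<open>T_bracket\<close>), so \<open>N(M,\<beta>)\<close> is a Virasoro module
  with \<open>c\<close> acting as \<open>0\<close>.

  For simplicity, let \<open>W\<close> be a submodule containing \<open>w \<noteq> 0\<close>. For fixed \<open>l\<close>, the vector
  \<open>T\<^sub>n T\<^sub>l\<^sub>-\<^sub>n w\<close> is a polynomial in the integer \<open>n\<close> with all values in \<open>W\<close>, so its
  coefficients are in \<open>W\<close> (\<open>poly_coefficients_in_subspace\<close>). The one of degree \<open>2s\<close> is a
  nonzero multiple of \<open>t\<^sup>l D\<^sub>r\<^sup>2 w\<close> (\<open>t_R_R_mem\<close>). Hence \<open>D\<^sub>r\<^sup>2 w\<close>, which is nonzero as \<open>D\<^sub>r\<close> is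
  injective, lies in \<open>U = {x. \<forall>l. t\<^sup>l x \<in> W}\<close>. This \<open>U\<close> is stable under all \<open>t\<^sup>l\<close> and, because
  \<open>T\<^sub>m t\<^sup>l - t\<^sup>l T\<^sub>m = l t\<^sup>l\<^sup>+\<^sup>m\<close>, under all \<open>T\<^sub>m\<close>, hence under \<open>F\<^sub>m = t\<^sup>-\<^sup>m T\<^sub>m\<close>, hence under its
  coefficients \<open>R\<^sub>i\<close> (\<open>t_core_R\<close>). Being stable under \<open>\<beta>\<close> as well, \<open>U\<close> is stable under
  \<open>\<partial>\<close>; so it is graded, its components all coincide up to shifts with one nonzero
  \<open>a\<^sub>r\<close>-submodule of \<open>M\<close>, which is \<open>M\<close> (\<open>t_R_stable_imp_UNIV\<close>). Thus \<open>U\<close>, and with it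
  \<open>W\<close>, is everything.
\<close>

section \<open>Polynomials with vector coefficients\<close>

locale complex_vector_space = vector_space scale
  for scale :: "complex \<Rightarrow> 'n::ab_group_add \<Rightarrow> 'n"
begin

lemma subspace_scale_cancel:
  assumes "subspace V" "scale a x \<in> V" "a \<noteq> 0"
  shows "x \<in> V"
  using subspace_scale[OF assms(1,2), of "inverse a"] assms(3) by simp

text \<open>
  If \<open>f m = \<Sum>\<^sub>i\<^sub>\<le>\<^sub>n m\<^sup>i w\<^sub>i\<close>, then \<open>f (2 m) - 2\<^sup>n f m\<close> has degree less than \<open>n\<close> and coefficients
  \<open>(2\<^sup>i - 2\<^sup>n) w\<^sub>i\<close>. Induction on this combination takes the place of inverting a Vandermonde
  matrix.
\<close>

lemma coefficients_in_subspace: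
  fixes w :: "nat \<Rightarrow> 'n"
  assumes V: "subspace V"
    and "\<And>m::int. (\<Sum>i<n. scale (of_int m ^ i) (w i)) \<in> V"
    and "i < n"
  shows "w i \<in> V"
  using assms(2,3)
proof (induction n arbitrary: w i)
  case 0
  then show ?case by simp
next
  case (Suc n)
  have lower: "w j \<in> V" if "j < n" for j
  proof -
    have "scale (2 ^ j - 2 ^ n) (w j) \<in> V"
    proof (rule Suc.IH[OF _ that])
      fix m :: int
      have "(\<Sum>i<n. scale (of_int m ^ i) (scale (2 ^ i - 2 ^ n) (w i))) =
        (\<Sum>i<Suc n. scale (of_int (2 * m) ^ i) (w i)) - scale (2 ^ n) (\<Sum>i<Suc n. scale (of_int m ^ i) (w i))"
        by (simp add: scale_sum_right algebra_simps power_mult_distrib sum_subtractf)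
      also have "\<dots> \<in> V"
        using Suc.prems(1) by (intro subspace_diff subspace_scale V)
      finally show "(\<Sum>i<n. scale (of_int m ^ i) (scale (2 ^ i - 2 ^ n) (w i))) \<in> V" .
    qed
    moreover have "(2::complex) ^ j - 2 ^ n \<noteq> 0"
    proof -
      have "(2::nat) ^ j \<noteq> 2 ^ n" using that by simp
      then have "of_nat (2 ^ j) \<noteq> (of_nat (2 ^ n) :: complex)" by (simp only: of_nat_eq_iff not_False_eq_True)
      then show ?thesis by simp
    qed
    ultimately show ?thesis by (rule subspace_scale_cancel[OF V])
  qed
  have "w n = (\<Sum>i<Suc n. scale (of_int 1 ^ i) (w i)) - (\<Sum>i<n. w i)" by simp
  also have "\<dots> \<in> V"
    by (rule subspace_diff[OF V Suc.prems(1)]) (intro subspace_sum V lower, simp)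
  finally show ?case using lower Suc.prems(2) by (auto simp: less_Suc_eq)
qed

lemma poly_coefficients_in_subspace:
  fixes p :: "'x \<Rightarrow> complex poly" and v :: "'x \<Rightarrow> 'n"
  assumes V: "subspace V" and "finite A"
    and mem: "\<And>m::int. (\<Sum>x\<in>A. scale (poly (p x) (of_int m)) (v x)) \<in> V"
  shows "(\<Sum>x\<in>A. scale (Polynomial.coeff (p x) k) (v x)) \<in> V"
proof -
  define n where "n = Suc (Max (insert k ((\<lambda>x. Polynomial.degree (p x)) ` A)))"
  have deg: "Polynomial.degree (p x) < n" if "x \<in> A" for x
    using that \<open>finite A\<close> by (auto simp: n_def less_Suc_eq_le)
  have "k < n"
    using \<open>finite A\<close> by (auto simp: n_def less_Suc_eq_le)
  have poly: "poly (p x) z = (\<Sum>i<n. Polynomial.coeff (p x) i * z ^ i)" if "x \<in> A" for x z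
    unfolding poly_altdef using deg[OF that]
    by (intro sum.mono_neutral_left) (auto simp: coeff_eq_0)
  have "(\<Sum>i<n. scale (of_int m ^ i) (\<Sum>x\<in>A. scale (Polynomial.coeff (p x) i) (v x))) \<in> V" for m
  proof -
    have "(\<Sum>i<n. scale (of_int m ^ i) (\<Sum>x\<in>A. scale (Polynomial.coeff (p x) i) (v x))) =
      (\<Sum>x\<in>A. \<Sum>i<n. scale (Polynomial.coeff (p x) i * of_int m ^ i) (v x))"
      by (subst sum.swap) (simp add: scale_sum_right mult.commute)
    also have "\<dots> = (\<Sum>x\<in>A. scale (poly (p x) (of_int m)) (v x))"
      by (simp add: poly scale_sum_left)
    finally show ?thesis using mem by simp
  qed
  then show ?thesis
    by (rule coefficients_in_subspace[OF V _ \<open>k < n\<close>,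
          of "\<lambda>i. \<Sum>x\<in>A. scale (Polynomial.coeff (p x) i) (v x)"])
qed

end

section \<open>Witt algebra actions from exponential generating functions\<close>

text \<open>The coefficients of the power series of \<open>exp (m x)\<close> in \<open>x\<close>.\<close>

definition exp_coeff :: "int \<Rightarrow> nat \<Rightarrow> complex"
  where "exp_coeff m i = of_int m ^ i / fact i"

lemma exp_coeff_0 [simp]: "exp_coeff m 0 = 1"
  by (simp add: exp_coeff_def)

lemma exp_coeff_Suc: "of_nat (Suc i) * exp_coeff m (Suc i) = of_int m * exp_coeff m i"
  by (simp add: exp_coeff_def field_simps del: of_nat_Suc)

lemma exp_coeff_add: "(\<Sum>i\<le>n. exp_coeff m i * exp_coeff k (n - i)) = exp_coeff (m + k) n"
  using exp_series_add_commuting[of "of_int m :: complex" "of_int k" n]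
  by (simp add: exp_coeff_def scaleR_conv_of_real divide_inverse mult_ac)

text \<open>
  The scalar identity behind the Witt relations. Without the two correction terms it says that
  \<open>e\<^sub>m e\<^sub>k' - e\<^sub>m' e\<^sub>k = (k - m) e\<^sub>m\<^sub>+\<^sub>k\<close> for \<open>e\<^sub>m = exp (m x)\<close>; they appear because the sum on the
  left omits the constant terms of the two series.
\<close>

lemma exp_coeff_bracket:
  "(\<Sum>i\<le>q. exp_coeff m (Suc i) * exp_coeff k (Suc (q - i)) * of_int (int (q - i) - int i)) =
    of_int (k - m) * exp_coeff (m + k) (Suc q)
    - of_int k * exp_coeff k (Suc q) + of_int m * exp_coeff m (Suc q)"
proof -
  have summand: "exp_coeff m (Suc i) * exp_coeff k (Suc j) * of_int (int j - int i) =
      of_int k * (exp_coeff m (Suc i) * exp_coeff k j) - of_int m * (exp_coeff m i * exp_coeff k (Suc j))"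
    for i j
  proof -
    have "exp_coeff m (Suc i) * exp_coeff k (Suc j) * of_int (int j - int i) =
      exp_coeff m (Suc i) * (of_nat (Suc j) * exp_coeff k (Suc j)) -
      (of_nat (Suc i) * exp_coeff m (Suc i)) * exp_coeff k (Suc j)"
      by (simp add: algebra_simps)
    then show ?thesis unfolding exp_coeff_Suc by (simp add: algebra_simps)
  qed
  have left: "(\<Sum>i\<le>q. exp_coeff m (Suc i) * exp_coeff k (q - i)) =
      exp_coeff (m + k) (Suc q) - exp_coeff k (Suc q)"
    unfolding exp_coeff_add[symmetric] sum.atMost_Suc_shift by simp
  have right: "(\<Sum>i\<le>q. exp_coeff m i * exp_coeff k (Suc (q - i))) =
      exp_coeff (m + k) (Suc q) - exp_coeff m (Suc q)"
    unfolding exp_coeff_add[symmetric] by (simp add: Suc_diff_le)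
  show ?thesis
    unfolding summand sum_subtractf sum_distrib_left[symmetric] left right
    by (simp add: left_diff_distrib right_diff_distrib)
qed

text \<open>
  The model is \<open>t k\<close> acting as \<open>t\<^sup>k\<close>, \<open>R 0\<close> as \<open>t d/dt\<close> plus a Laurent polynomial, and
  \<open>R (Suc i)\<close> as the generator \<open>d\<^sub>i\<close> of the algebra of vector fields with nonnegative degree,
  those of degree at least \<open>s\<close> acting as \<open>0\<close>. The index is shifted because \<open>d\<^sub>i\<close> comes with the
  coefficient \<open>m\<^sup>i\<^sup>+\<^sup>1/(i + 1)!\<close>, so that \<open>R 0\<close> fills the vacant constant term.
\<close>

locale exponential_witt = complex_vector_space scale
  for scale :: "complex \<Rightarrow> 'n::ab_group_add \<Rightarrow> 'n" +
  fixes t :: "int \<Rightarrow> 'n \<Rightarrow> 'n" and R :: "nat \<Rightarrow> 'n \<Rightarrow> 'n" and s :: nat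
  assumes t_linear: "Vector_Spaces.linear scale scale (t k)"
    and R_linear: "Vector_Spaces.linear scale scale (R i)"
    and t_t: "t k (t l w) = t (k + l) w"
    and t_0: "t 0 w = w"
    and R_0_t: "R 0 (t k w) = t k (R 0 w) + scale (of_int k) (t k w)"
    and R_Suc_t: "R (Suc i) (t k w) = t k (R (Suc i) w)"
    and R_0_R: "R 0 (R (Suc i) w) = R (Suc i) (R 0 w)"
    and R_bracket: "R (Suc i) (R (Suc j) w) - R (Suc j) (R (Suc i) w) =
      scale (of_int (int j - int i)) (R (Suc (i + j)) w)"
    and R_vanish: "i > s \<Longrightarrow> R i w = 0"
begin

sublocale t: Vector_Spaces.linear scale scale "t k" for k by (rule t_linear)

sublocale R: Vector_Spaces.linear scale scale "R i" for i by (rule R_linear)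

definition F :: "int \<Rightarrow> 'n \<Rightarrow> 'n"
  where "F m w = (\<Sum>i\<le>s. scale (exp_coeff m i) (R i w))"

definition T :: "int \<Rightarrow> 'n \<Rightarrow> 'n"
  where "T m w = t m (F m w)"

definition P :: "int \<Rightarrow> 'n \<Rightarrow> 'n"
  where "P m w = (\<Sum>i\<le>s. scale (exp_coeff m (Suc i)) (R (Suc i) w))"

text \<open>
  The top summand of \<open>P\<close> involves \<open>R (Suc s)\<close> and is \<open>0\<close>; it is kept so that both sums have the
  same index set, also for \<open>s = 0\<close>.
\<close>

lemma F_eq: "F m w = R 0 w + P m w"
proof -
  have "F m w = (\<Sum>i\<le>Suc s. scale (exp_coeff m i) (R i w))"
    by (simp add: F_def R_vanish)
  also have "\<dots> = R 0 w + P m w"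
    unfolding sum.atMost_Suc_shift P_def by simp
  finally show ?thesis .
qed

lemma P_linear: "P m (x + y) = P m x + P m y" "P m (scale a x) = scale a (P m x)"
  by (simp_all add: P_def R.add R.scale scale_right_distrib sum.distrib scale_sum_right mult.commute)

lemma F_linear: "F m (x + y) = F m x + F m y" "F m (scale a x) = scale a (F m x)"
  by (simp_all add: F_eq R.add R.scale P_linear algebra_simps)

lemma F_t: "F m (t k w) = t k (F m w) + scale (of_int k) (t k w)"
  by (simp add: F_eq P_def R_0_t R_Suc_t t.add t.sum t.scale)

lemma P_bracket:
  "P m (P k w) - P k (P m w) =
    scale (of_int (k - m)) (P (m + k) w) - scale (of_int k) (P k w) + scale (of_int m) (P m w)"
proof -
  define g where "g i j = scale (exp_coeff m (Suc i) * exp_coeff k (Suc j) * of_int (int j - int i))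
    (R (Suc (i + j)) w)" for i j
  have vanish: "g i j = 0" if "s < i + j" for i j
    using that by (simp add: g_def R_vanish)
  have PP: "P a (P b w) = (\<Sum>i\<le>s. \<Sum>j\<le>s. scale (exp_coeff a (Suc i) * exp_coeff b (Suc j))
    (R (Suc i) (R (Suc j) w)))" for a b
    by (simp add: P_def R.sum R.scale scale_sum_right)
  have PP': "P k (P m w) = (\<Sum>i\<le>s. \<Sum>j\<le>s. scale (exp_coeff m (Suc i) * exp_coeff k (Suc j))
    (R (Suc j) (R (Suc i) w)))"
    unfolding PP by (subst sum.swap) (simp add: mult.commute)
  have "P m (P k w) - P k (P m w) = (\<Sum>i\<le>s. \<Sum>j\<le>s. g i j)"
    unfolding PP[of m k] PP'
    by (simp add: sum_subtractf[symmetric] scale_right_diff_distrib[symmetric] R_bracket g_def)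
  also have "\<dots> = (\<Sum>(i, j)\<in>{..s} \<times> {..s}. g i j)"
    by (simp add: sum.cartesian_product)
  also have "\<dots> = (\<Sum>(i, j)\<in>{(i, j). i + j \<le> s}. g i j)"
    by (rule sum.mono_neutral_right) (auto, metis vanish not_le)
  also have "\<dots> = (\<Sum>q\<le>s. \<Sum>i\<le>q. g i (q - i))"
    by (rule sum.triangle_reindex_eq)
  also have "\<dots> = (\<Sum>q\<le>s. scale (\<Sum>i\<le>q. exp_coeff m (Suc i) * exp_coeff k (Suc (q - i)) *
      of_int (int (q - i) - int i)) (R (Suc q) w))"
    by (simp add: g_def scale_sum_left)
  also have "\<dots> = scale (of_int (k - m)) (P (m + k) w) - scale (of_int k) (P k w) + scale (of_int m) (P m w)"
    unfolding exp_coeff_bracket P_def scale_left_distrib scale_left_diff_distrib scale_scale[symmetric]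
      sum.distrib sum_subtractf scale_sum_right ..
  finally show ?thesis .
qed

text \<open>Moving \<open>t k\<close> to the left past \<open>F m\<close> produces the extra multiple of \<open>F k w\<close>.\<close>

lemma T_T: "T m (T k w) = t (m + k) (F m (F k w) + scale (of_int k) (F k w))"
  by (simp add: T_def F_t F_linear t.add t.scale t_t)

theorem T_bracket: "T m (T k w) - T k (T m w) = scale (of_int (k - m)) (T (m + k) w)"
proof -
  have R0P: "R 0 (P a x) = P a (R 0 x)" for a x
    by (simp add: P_def R.sum R.scale R_0_R)
  have "F m (F k w) + scale (of_int k) (F k w) - (F k (F m w) + scale (of_int m) (F m w)) =
    (P m (P k w) - P k (P m w)) + scale (of_int k) (F k w) - scale (of_int m) (F m w)"
    by (simp add: F_eq R.add P_linear R0P)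
  also have "\<dots> = scale (of_int (k - m)) (F (m + k) w)"
    unfolding P_bracket by (simp add: F_eq algebra_simps)
  finally show ?thesis
    unfolding T_T add.commute[of k m] by (simp add: T_def t.diff[symmetric] t.scale)
qed

text \<open>
  For fixed \<open>l\<close>, \<open>T n (T (l - n) w)\<close> is \<open>t l\<close> applied to a product of two polynomials in \<open>n\<close> of
  degree \<open>s\<close>, with leading terms \<open>n\<^sup>s/s! R s\<close> and \<open>(-n)\<^sup>s/s! R s\<close>. The condition \<open>2 \<le> s\<close> keeps the
  leading term of the first factor clear of the linear term \<open>l - n\<close> that \<open>T_T\<close> adds to \<open>F n\<close>.
\<close>

lemma t_R_R_mem:
  assumes "2 \<le> s" and W: "subspace W" and T_W: "\<And>m w. w \<in> W \<Longrightarrow> T m w \<in> W" and "w \<in> W"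
  shows "t l (R s (R s w)) \<in> W"
proof -
  \<comment> \<open>The term \<open>l - n\<close> is absorbed into the coefficients of degrees \<open>0\<close> and \<open>1\<close> of \<open>F n\<close>.\<close>
  define R' where "R' i x = (if i = 0 then R 0 x + scale (of_int l) x
    else if i = 1 then R 1 x - x else R i x)" for i x
  have R': "F n x + scale (of_int (l - n)) x = (\<Sum>i\<le>s. scale (exp_coeff n i) (R' i x))" for n x
  proof -
    have "R' i x = R i x + ((if i = 0 then scale (of_int l) x else 0) + (if i = 1 then - x else 0))" for i
      by (simp add: R'_def)
    then have "(\<Sum>i\<le>s. scale (exp_coeff n i) (R' i x)) = F n x +
      ((\<Sum>i\<le>s. if i = 0 then scale (of_int l) x else 0) + (\<Sum>i\<le>s. if i = 1 then - scale (exp_coeff n 1) x else 0))"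
      by (simp only: scale_right_distrib sum.distrib F_def)
         (intro arg_cong2[of _ _ _ _ "(+)"] refl sum.cong; auto)
    also have "\<dots> = F n x + scale (of_int (l - n)) x"
      using \<open>2 \<le> s\<close> by (simp add: sum.delta exp_coeff_def algebra_simps)
    finally show ?thesis by simp
  qed
  define p :: "nat \<times> nat \<Rightarrow> complex poly"
    where "p = (\<lambda>(i, j). smult (1 / (fact i * fact j)) ([:0, 1:] ^ i * [:of_int l, -1:] ^ j))"
  define v where "v = (\<lambda>(i, j). t l (R' i (R j w)))"
  have deg: "Polynomial.degree (p (i, j)) = i + j" for i j
    by (simp add: p_def degree_mult_eq degree_power_eq)
  have "(\<Sum>x\<in>{..s} \<times> {..s}. scale (poly (p x) (of_int n)) (v x)) \<in> W" for n
  proof -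
    have R'_sum: "R' i (\<Sum>j\<le>s. scale (c j) (R j w)) = (\<Sum>j\<le>s. scale (c j) (R' i (R j w)))" for i c
      by (simp add: R'_def R.sum R.scale scale_sum_right sum.distrib sum_subtractf algebra_simps)
    have "T n (T (l - n) w) = t l (\<Sum>i\<le>s. scale (exp_coeff n i) (R' i (F (l - n) w)))"
      unfolding T_T R' by simp
    also have "\<dots> = (\<Sum>i\<le>s. \<Sum>j\<le>s. scale (exp_coeff n i * exp_coeff (l - n) j) (t l (R' i (R j w))))"
      by (simp add: F_def[of "l - n"] R'_sum t.sum t.scale scale_sum_right)
    also have "\<dots> = (\<Sum>x\<in>{..s} \<times> {..s}. scale (poly (p x) (of_int n)) (v x))"
      unfolding sum.cartesian_product
      by (intro sum.cong refl) (auto simp: p_def v_def exp_coeff_def field_simps)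
    finally show ?thesis using T_W[OF T_W[OF \<open>w \<in> W\<close>], of n "l - n"] by (simp only:)
  qed
  then have "(\<Sum>x\<in>{..s} \<times> {..s}. scale (Polynomial.coeff (p x) (s + s)) (v x)) \<in> W"
    by (intro poly_coefficients_in_subspace[OF W]) auto
  \<comment> \<open>Every other summand has degree below \<open>2s\<close>.\<close>
  also have "(\<Sum>x\<in>{..s} \<times> {..s}. scale (Polynomial.coeff (p x) (s + s)) (v x)) =
      (\<Sum>x\<in>{(s, s)}. scale (Polynomial.coeff (p x) (s + s)) (v x))"
  proof (rule sum.mono_neutral_right)
    show "\<forall>x\<in>{..s} \<times> {..s} - {(s, s)}. scale (Polynomial.coeff (p x) (s + s)) (v x) = 0"
    proof
      fix x assume "x \<in> {..s} \<times> {..s} - {(s, s)}"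
      then have "Polynomial.degree (p x) < s + s" by (cases x) (auto simp: deg)
      then show "scale (Polynomial.coeff (p x) (s + s)) (v x) = 0" by (simp add: coeff_eq_0)
    qed
  qed auto
  also have "\<dots> = scale (Polynomial.lead_coeff (p (s, s))) (t l (R s (R s w)))"
    using \<open>2 \<le> s\<close> by (simp add: deg v_def R'_def)
  finally have "scale (Polynomial.lead_coeff (p (s, s))) (t l (R s (R s w))) \<in> W" .
  moreover have "Polynomial.lead_coeff (p (s, s)) \<noteq> 0" by (simp add: p_def)
  ultimately show ?thesis by (rule subspace_scale_cancel[OF W])
qed

text \<open>The largest subset of \<open>W\<close> that is stable under all \<open>t k\<close>.\<close>

definition t_core :: "'n set \<Rightarrow> 'n set"
  where "t_core W = {w. \<forall>l. t l w \<in> W}"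

lemma t_core_subset: "t_core W \<subseteq> W"
  unfolding t_core_def by (metis (mono_tags, lifting) mem_Collect_eq subsetI t_0)

lemma t_core_t: "w \<in> t_core W \<Longrightarrow> t k w \<in> t_core W"
  by (simp add: t_core_def t_t)

lemma subspace_t_core: "subspace W \<Longrightarrow> subspace (t_core W)"
  unfolding t_core_def subspace_def by (auto simp: t.zero t.add t.scale)

text \<open>
  On the core, \<open>F m = t\<^sup>-\<^sup>m T m\<close> makes sense as an operator, and the \<open>R i\<close> are its coefficients as a
  polynomial in \<open>m\<close>.
\<close>

lemma t_core_R:
  assumes W: "subspace W" and T_W: "\<And>m w. w \<in> W \<Longrightarrow> T m w \<in> W" and w: "w \<in> t_core W"
  shows "R i w \<in> t_core W"
proof (cases "i \<le> s")
  case True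
  note core = subspace_t_core[OF W]
  have F: "F m w \<in> t_core W" for m
  proof -
    have "t l (T m w) = T m (t l w) - scale (of_int l) (t m (t l w))" for l
      by (simp add: T_def F_t t_t t.add t.scale add.commute)
    then have "T m w \<in> t_core W"
      using w T_W by (auto simp: t_core_def t_t intro!: subspace_diff subspace_scale W)
    then have "t (- m) (T m w) \<in> t_core W" by (rule t_core_t)
    then show ?thesis by (simp add: T_def t_t t_0)
  qed
  have "(\<Sum>j\<le>s. scale (Polynomial.coeff (Polynomial.monom (1 / fact j) j) i) (R j w)) \<in> t_core W"
  proof (rule poly_coefficients_in_subspace[OF core])
    fix m :: int
    show "(\<Sum>j\<le>s. scale (poly (Polynomial.monom (1 / fact j) j) (of_int m)) (R j w)) \<in> t_core W"
      using F[of m] by (simp add: F_def exp_coeff_def poly_monom)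
  qed simp
  also have "(\<Sum>j\<le>s. scale (Polynomial.coeff (Polynomial.monom (1 / fact j) j) i) (R j w)) = scale (1 / fact i) (R i w)"
    using True by (simp add: if_distrib[of "\<lambda>a. scale a _"] cong: if_cong)
  finally have "scale (1 / fact i) (R i w) \<in> t_core W" .
  then show ?thesis by (rule subspace_scale_cancel[OF core]) simp
next
  case False
  then show ?thesis using subspace_0[OF subspace_t_core[OF W]] by (simp add: R_vanish)
qed

end


section \<open>Generators of the quotient algebra\<close>

lemma vir_a_zero: "\<zero>\<^bsub>vir_a r\<^esub> = vir_plus_ideal r"
  by (simp add: vir_a_def lie_quotient_def)

lemma d_bar_vanish:
  assumes "i > r"
  shows "d_bar r i = \<zero>\<^bsub>vir_a r\<^esub>"
proof -
  have sub: "vir.subspace (vir_plus_ideal r)" by (simp add: vir_plus_ideal_eq)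
  have mem: "vir_d (int i) \<in> vir_plus_ideal r"
    using assms by (auto simp: vir_plus_ideal_eq intro!: vir.span_base)
  have coset: "d_bar r i = (\<lambda>h. h + vir_d (int i)) ` vir_plus_ideal r"
    by (auto simp: d_bar_def a_r_coset_def' vir_plus_def)
  have "(\<lambda>h. h + vir_d (int i)) ` vir_plus_ideal r = vir_plus_ideal r"
  proof
    show "vir_plus_ideal r \<subseteq> (\<lambda>h. h + vir_d (int i)) ` vir_plus_ideal r"
    proof
      fix h assume "h \<in> vir_plus_ideal r"
      then have "h - vir_d (int i) \<in> vir_plus_ideal r" by (intro vir.subspace_diff sub mem)
      then show "h \<in> (\<lambda>h. h + vir_d (int i)) ` vir_plus_ideal r" by (rule rev_image_eqI) simp
    qed
  qed (auto intro: vir.subspace_add[OF sub] mem)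
  then show ?thesis by (simp add: coset vir_a_zero)
qed

lemma vir_plus_simps:
  "carrier vir_plus = vir.span {vir_d i | i. i \<ge> 0}" "x \<oplus>\<^bsub>vir_plus\<^esub> y = x + y"
  "x \<otimes>\<^bsub>vir_plus\<^esub> y = vir_bracket x y" "a \<odot>\<^bsub>vir_plus\<^esub> x = vir_scale a x"
  by (simp_all add: vir_plus_def)

lemma vir_d_mem_vir_plus: "vir_d (int i) \<in> carrier vir_plus"
  by (auto simp: vir_plus_simps intro!: vir.span_base)

lemmas vir_a_coset = lie_algebra_quotient(2-4)[OF lie_algebra_vir_plus lie_ideal_vir_plus_ideal,
    folded vir_a_def]

lemma d_bar_bracket:
  "d_bar r i \<otimes>\<^bsub>vir_a r\<^esub> d_bar r j = of_int (int j - int i) \<odot>\<^bsub>vir_a r\<^esub> d_bar r (i + j)"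
proof -
  have "vir_bracket (vir_d (int i)) (vir_d (int j)) = vir_scale (of_int (int j - int i)) (vir_d (int (i + j)))"
  proof (cases "int i = - int j")
    case True
    then have "i = 0" "j = 0" by auto
    then show ?thesis by (simp add: vir_brackets)
  qed (simp add: vir_brackets)
  then show ?thesis
    using vir_a_coset(1)[OF vir_d_mem_vir_plus[of "i + j"], of r "of_int (int j - int i)"]
    by (simp only: d_bar_def vir_a_coset(3)[OF vir_d_mem_vir_plus vir_d_mem_vir_plus] vir_plus_simps)
qed

lemma vir_a_carrier: "carrier (vir_a r) = (\<lambda>u. vir_plus_ideal r +>\<^bsub>vir_plus\<^esub> u) ` carrier vir_plus"
  by (auto simp: vir_a_def lie_quotient_def A_RCOSETS_def')

text \<open>
  The cosets of the \<open>vir_d i\<close> with \<open>i \<ge> 0\<close> span \<open>vir_a r\<close>, so stability under them suffices for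
  being a submodule.
\<close>

lemma d_bar_stable_imp_stable:
  assumes "lie_module (vir_a r) scale \<rho>" and "module.subspace scale W"
    and D: "\<And>i w. w \<in> W \<Longrightarrow> \<rho> (d_bar r i) w \<in> W"
    and "x \<in> carrier (vir_a r)" "w \<in> W"
  shows "\<rho> x w \<in> W"
proof -
  interpret lie_module "vir_a r" scale \<rho> by (fact assms(1))
  let ?c = "\<lambda>u. vir_plus_ideal r +>\<^bsub>vir_plus\<^esub> u"
  define S where "S = {u \<in> carrier vir_plus. \<forall>w\<in>W. \<rho> (?c u) w \<in> W}"
  have zero: "\<rho> \<zero>\<^bsub>vir_a r\<^esub> v = 0" for v
    using action_add[OF L.zero_closed L.zero_closed, of v] by simp
  have c: "?c u \<in> carrier (vir_a r)" if "u \<in> carrier vir_plus" for u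
    using that by (auto simp: vir_a_carrier)
  have c0: "?c 0 = \<zero>\<^bsub>vir_a r\<^esub>"
    by (auto simp: vir_a_zero a_r_coset_def' vir_plus_simps)
  have add: "\<rho> (?c (u + v)) w = \<rho> (?c u) w + \<rho> (?c v) w"
    if "u \<in> carrier vir_plus" "v \<in> carrier vir_plus" for u v w
    using vir_a_coset(2)[OF that, of r] action_add[OF c[OF that(1)] c[OF that(2)], of w]
    by (simp add: vir_plus_simps(2))
  have smult: "\<rho> (?c (vir_scale a u)) w = scale a (\<rho> (?c u) w)"
    if "u \<in> carrier vir_plus" for u a w
    using vir_a_coset(1)[OF that, of r a] action_smult[OF c[OF that], of a w]
    by (simp add: vir_plus_simps(4))
  have sub: "vir.subspace S"
    unfolding vir.subspace_def
  proof (intro conjI ballI allI)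
    show "0 \<in> S"
      using V.subspace_0[OF assms(2)]
      by (simp add: S_def c0 zero vir_plus_simps vir.span_zero)
  next
    fix u v assume "u \<in> S" "v \<in> S"
    then show "u + v \<in> S"
      using V.subspace_add[OF assms(2)] vir.span_add by (auto simp: S_def add) (simp add: vir_plus_simps vir.span_add)
  next
    fix a u assume "u \<in> S"
    then show "vir_scale a u \<in> S"
      using V.subspace_scale[OF assms(2)] by (auto simp: S_def smult) (simp add: vir_plus_simps vir.span_scale)
  qed
  obtain u where u: "u \<in> carrier vir_plus" "x = ?c u"
    using assms(4) by (auto simp: vir_a_carrier)
  have "{vir_d i | i. i \<ge> 0} \<subseteq> S"
  proof
    fix y assume "y \<in> {vir_d i | i. i \<ge> 0}"
    then obtain i where y: "y = vir_d (int i)" using zero_le_imp_eq_int by auto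
    show "y \<in> S"
      using D[of _ i] vir_d_mem_vir_plus[of i] by (auto simp: S_def y d_bar_def)
  qed
  then have "u \<in> S"
    using vir.span_minimal[OF _ sub] u(1) by (auto simp: vir_plus_simps)
  then show ?thesis using u(2) \<open>w \<in> W\<close> by (simp add: S_def)
qed

section \<open>Operators on finitely supported functions\<close>

lemma lookup_t_shift: "Poly_Mapping.lookup (t_shift k w) n = Poly_Mapping.lookup w (n - k)"
  unfolding t_shift_def by (subst map_key.rep_eq) (auto simp: inj_def)

lemma t_shift_single: "t_shift k (Poly_Mapping.single n v) = Poly_Mapping.single (n + k) v"
  by (rule poly_mapping_eqI) (auto simp: lookup_t_shift lookup_single when_def)

lemma sum_single_lookup:
  "w = (\<Sum>k\<in>Poly_Mapping.keys w. Poly_Mapping.single k (Poly_Mapping.lookup w k))"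
  by (rule poly_mapping_eqI) (simp add: lookup_sum lookup_single when_def in_keys_iff)

lemma lookup_laurent_act:
  assumes "vector_space scale"
  shows "Poly_Mapping.lookup (laurent_act scale \<beta> w) n =
    (\<Sum>k\<in>Poly_Mapping.keys \<beta>. scale (Poly_Mapping.lookup \<beta> k) (Poly_Mapping.lookup w (n - k)))"
proof -
  interpret vector_space scale by (fact assms)
  show ?thesis
    by (simp add: laurent_act_def lin_ext_def lookup_sum lookup_pm_scale lookup_t_shift)
qed

lemma laurent_act_times_single:
  assumes "vector_space scale"
  shows "laurent_act scale (\<beta> * Poly_Mapping.single m 1) w = t_shift m (laurent_act scale \<beta> w)"
proof (rule poly_mapping_eqI)
  fix n
  interpret vector_space scale by (fact assms)
  have lookup: "Poly_Mapping.lookup (\<beta> * Poly_Mapping.single m 1) k = Poly_Mapping.lookup \<beta> (k - m)" for k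
  proof -
    have "\<beta> * Poly_Mapping.single m 1 =
      (\<Sum>j\<in>Poly_Mapping.keys \<beta>. Poly_Mapping.single (j + m) (Poly_Mapping.lookup \<beta> j))"
      by (subst sum_single_lookup[of \<beta>]) (simp add: sum_distrib_right mult_single)
    moreover have "j + m = k \<longleftrightarrow> j = k - m" for j by auto
    ultimately show ?thesis
      by (simp add: lookup_sum lookup_single when_def in_keys_iff)
  qed
  have keys: "Poly_Mapping.keys (\<beta> * Poly_Mapping.single m 1) = (\<lambda>k. k + m) ` Poly_Mapping.keys \<beta>"
  proof (rule Set.set_eqI)
    fix k
    have "k \<in> (\<lambda>k. k + m) ` Poly_Mapping.keys \<beta> \<longleftrightarrow> k - m \<in> Poly_Mapping.keys \<beta>"
      by (auto intro: rev_image_eqI[of "k - m"])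
    then show "k \<in> Poly_Mapping.keys (\<beta> * Poly_Mapping.single m 1) \<longleftrightarrow>
        k \<in> (\<lambda>k. k + m) ` Poly_Mapping.keys \<beta>"
      by (simp add: in_keys_iff lookup)
  qed
  show "Poly_Mapping.lookup (laurent_act scale (\<beta> * Poly_Mapping.single m 1) w) n =
      Poly_Mapping.lookup (t_shift m (laurent_act scale \<beta> w)) n"
    by (simp add: lookup_laurent_act[OF assms] lookup_t_shift keys sum.reindex inj_on_def lookup
        algebra_simps)
qed

definition degree_op :: "(complex \<Rightarrow> 'm \<Rightarrow> 'm) \<Rightarrow> (int \<Rightarrow>\<^sub>0 'm::zero) \<Rightarrow> (int \<Rightarrow>\<^sub>0 'm)"
  where "degree_op scale w = Poly_Mapping.mapp (\<lambda>n. scale (of_int n)) w"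

lemma lookup_degree_op:
  assumes "vector_space scale"
  shows "Poly_Mapping.lookup (degree_op scale w) n = scale (of_int n) (Poly_Mapping.lookup w n)"
proof -
  interpret vector_space scale by (fact assms)
  show ?thesis by (simp add: degree_op_def lookup_mapp when_def in_keys_iff)
qed

text \<open>
  The components of \<open>w\<close> are eigenvectors of \<open>degree_op\<close> with distinct eigenvalues. The product of
  the operators \<open>degree_op - i\<close> over the other degrees \<open>i\<close> in the support of \<open>w\<close> kills all
  components except the one of degree \<open>n\<close>.
\<close>

lemma homogeneous_component_mem:
  assumes "vector_space scale" and U: "module.subspace (pm_scale scale) U"
    and deg: "\<And>w. w \<in> U \<Longrightarrow> degree_op scale w \<in> U" and "w \<in> U"
  shows "Poly_Mapping.single n (Poly_Mapping.lookup w n) \<in> U"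
proof -
  interpret vector_space scale by (fact assms(1))
  interpret N: complex_vector_space "pm_scale scale :: _ \<Rightarrow> (int \<Rightarrow>\<^sub>0 'a) \<Rightarrow> _"
    unfolding complex_vector_space_def by (rule vector_space_pm_scale) (rule assms)
  have "\<exists>x\<in>U. \<forall>j. Poly_Mapping.lookup x j = scale (\<Prod>i\<in>S. of_int (j - i)) (Poly_Mapping.lookup w j)"
    if "finite S" for S
    using that
  proof (induction S)
    case empty
    then show ?case using \<open>w \<in> U\<close> by auto
  next
    case (insert a S)
    then obtain x where x: "x \<in> U"
      "\<And>j. Poly_Mapping.lookup x j = scale (\<Prod>i\<in>S. of_int (j - i)) (Poly_Mapping.lookup w j)" by blast
    have "degree_op scale x - pm_scale scale (of_int a) x \<in> U"
      using x(1) by (intro N.subspace_diff N.subspace_scale U deg)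
    moreover have "Poly_Mapping.lookup (degree_op scale x - pm_scale scale (of_int a) x) j =
        scale (\<Prod>i\<in>insert a S. of_int (j - i)) (Poly_Mapping.lookup w j)" for j
      using insert.hyps
      by (simp add: lookup_minus lookup_degree_op[OF assms(1)] lookup_pm_scale x(2)
          scale_left_diff_distrib left_diff_distrib)
    ultimately show ?case by blast
  qed
  from this[of "Poly_Mapping.keys w - {n}"] obtain x where x: "x \<in> U"
    "\<And>j. Poly_Mapping.lookup x j =
      scale (\<Prod>i\<in>Poly_Mapping.keys w - {n}. of_int (j - i)) (Poly_Mapping.lookup w j)" by auto
  define c :: complex where "c = (\<Prod>i\<in>Poly_Mapping.keys w - {n}. of_int (n - i))"
  have "x = pm_scale scale c (Poly_Mapping.single n (Poly_Mapping.lookup w n))"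
  proof (rule poly_mapping_eqI)
    fix j
    consider "j = n" | "j \<noteq> n" "j \<in> Poly_Mapping.keys w" | "j \<noteq> n" "Poly_Mapping.lookup w j = 0"
      by (auto simp: in_keys_iff)
    then show "Poly_Mapping.lookup x j =
        Poly_Mapping.lookup (pm_scale scale c (Poly_Mapping.single n (Poly_Mapping.lookup w n))) j"
    proof cases
      case 2
      then have "(\<Prod>i\<in>Poly_Mapping.keys w - {n}. of_int (j - i) :: complex) = 0"
        by (intro prod_zero) auto
      with 2 show ?thesis by (simp add: x(2) lookup_pm_scale lookup_single when_def)
    qed (simp_all add: x(2) lookup_pm_scale lookup_single when_def c_def)
  qed
  moreover have "c \<noteq> 0" by (simp add: c_def)
  ultimately show ?thesis using x(1) by (metis N.subspace_scale_cancel[OF U])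
qed

lemma linear_eq_on_vir_basis:
  assumes "Vector_Spaces.linear vir_scale s f" "Vector_Spaces.linear vir_scale s g"
    and "\<And>x. f (Poly_Mapping.single x 1) = g (Poly_Mapping.single x 1)"
  shows "f u = g u"
proof -
  interpret f: Vector_Spaces.linear vir_scale s f by (fact assms(1))
  interpret g: Vector_Spaces.linear vir_scale s g by (fact assms(2))
  have "vir.subspace {u. f u = g u}"
    by (auto simp: vir.subspace_def f.zero g.zero f.add g.add f.scale g.scale)
  then have "vir.span (range (\<lambda>x. Poly_Mapping.single x 1)) \<subseteq> {u. f u = g u}"
    using assms(3) by (intro vir.span_minimal) auto
  then show ?thesis by (auto simp: vir_span_basis)
qed

section \<open>The twisted modules\<close>

locale loop_module = lie_module "vir_a r" scale \<rho>
  for r :: nat and scale :: "complex \<Rightarrow> 'm::ab_group_add \<Rightarrow> 'm" and \<rho> +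
  fixes \<beta> :: laurent
begin

abbreviation D :: "nat \<Rightarrow> 'm \<Rightarrow> 'm" where "D i \<equiv> \<rho> (d_bar r i)"

sublocale D: Vector_Spaces.linear scale scale "D i" for i
  by (rule action_linear[OF vir_d_bar_mem])

lemma D_bracket: "D i (D j v) - D j (D i v) = scale (of_int (int j - int i)) (D (i + j) v)"
  using action_bracket[OF vir_d_bar_mem[of r i] vir_d_bar_mem[of r j], of v]
    action_smult[OF vir_d_bar_mem[of r "i + j"], of "of_int (int j - int i)" v]
  by (simp add: d_bar_bracket)

lemma D_vanish: "i > r \<Longrightarrow> D i v = 0"
  using action_add[OF L.zero_closed L.zero_closed, of v] by (simp add: d_bar_vanish)

definition R :: "nat \<Rightarrow> (int \<Rightarrow>\<^sub>0 'm) \<Rightarrow> (int \<Rightarrow>\<^sub>0 'm)"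
  where "R i w = (case i of 0 \<Rightarrow> degree_op scale w + laurent_act scale \<beta> w
    | Suc j \<Rightarrow> Poly_Mapping.map (D j) w)"

lemma lookup_R_0: "Poly_Mapping.lookup (R 0 w) n = scale (of_int n) (Poly_Mapping.lookup w n) +
    (\<Sum>k\<in>Poly_Mapping.keys \<beta>. scale (Poly_Mapping.lookup \<beta> k) (Poly_Mapping.lookup w (n - k)))"
  by (simp add: R_def lookup_add lookup_degree_op lookup_laurent_act V.vector_space_axioms)

lemma lookup_R_Suc: "Poly_Mapping.lookup (R (Suc i) w) n = D i (Poly_Mapping.lookup w n)"
  by (simp add: R_def Poly_Mapping.map.rep_eq when_def D.zero)

lemma pm_vector_space: "vector_space (pm_scale scale :: _ \<Rightarrow> ('x \<Rightarrow>\<^sub>0 'm) \<Rightarrow> _)"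
  by (rule vector_space_pm_scale) (rule V.vector_space_axioms)

sublocale N: exponential_witt "pm_scale scale" t_shift R "Suc r"
proof -
  interpret P: vector_space "pm_scale scale :: _ \<Rightarrow> (int \<Rightarrow>\<^sub>0 'm) \<Rightarrow> _" by (rule pm_vector_space)
  show "exponential_witt (pm_scale scale) t_shift R (Suc r)"
  proof
    show "t_shift k (x + y) = t_shift k x + t_shift k y"
      "t_shift k (pm_scale scale a x) = pm_scale scale a (t_shift k x)"
      "t_shift k (t_shift l x) = t_shift (k + l) x" "t_shift 0 x = x" for k l a and x y :: "int \<Rightarrow>\<^sub>0 'm"
      by (auto intro!: poly_mapping_eqI simp: lookup_t_shift lookup_add lookup_pm_scale algebra_simps)
    show "R i (x + y) = R i x + R i y" "R i (pm_scale scale a x) = pm_scale scale a (R i x)" for i x y a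
      by (cases i; auto intro!: poly_mapping_eqI simp: lookup_R_0 lookup_R_Suc lookup_add
          lookup_pm_scale D.add D.scale V.scale_right_distrib V.scale_sum_right sum.distrib mult.commute)+
    show "R 0 (t_shift k w) = t_shift k (R 0 w) + pm_scale scale (of_int k) (t_shift k w)" for k w
    proof (rule poly_mapping_eqI)
      fix n
      show "Poly_Mapping.lookup (R 0 (t_shift k w)) n =
          Poly_Mapping.lookup (t_shift k (R 0 w) + pm_scale scale (of_int k) (t_shift k w)) n"
        by (simp add: lookup_R_0 lookup_t_shift lookup_add lookup_pm_scale V.scale_left_diff_distrib
            diff_diff_eq add.commute)
    qed
    show "R (Suc i) (t_shift k w) = t_shift k (R (Suc i) w)" for i k w
      by (rule poly_mapping_eqI) (simp add: lookup_R_Suc lookup_t_shift)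
    show "R 0 (R (Suc i) w) = R (Suc i) (R 0 w)" for i w
      by (rule poly_mapping_eqI) (simp add: lookup_R_0 lookup_R_Suc D.add D.scale D.sum)
    show "R (Suc i) (R (Suc j) w) - R (Suc j) (R (Suc i) w) =
        pm_scale scale (of_int (int j - int i)) (R (Suc (i + j)) w)" for i j w
      by (rule poly_mapping_eqI) (simp add: lookup_minus lookup_R_Suc lookup_pm_scale D_bracket)
    show "R i w = 0" if "Suc r < i" for i w
      using that by (cases i) (auto intro!: poly_mapping_eqI simp: lookup_R_Suc D_vanish)
  qed
qed

lemma N_basis_act_Vd: "N_basis_act r scale \<rho> \<beta> (Vd m) w = N.T m w"
proof -
  have "N0_d r scale \<rho> m w = t_shift m (degree_op scale w + N.P m w)"
  proof (rule poly_mapping_eqI)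
    fix n
    let ?f = "\<lambda>j v. scale (of_int j) v +
      (\<Sum>i=0..r. scale (of_int m ^ (i + 1) / fact (i + 1)) (D i v))"
    have "Poly_Mapping.lookup (N0_d r scale \<rho> m w) n =
      (\<Sum>j\<in>Poly_Mapping.keys w. if j = n - m then ?f j (Poly_Mapping.lookup w j) else 0)"
      unfolding N0_d_def lookup_sum Let_def lookup_single when_def
      by (intro sum.cong refl if_cong) auto
    also have "\<dots> = ?f (n - m) (Poly_Mapping.lookup w (n - m))"
      by (simp add: in_keys_iff D.zero)
    also have "\<dots> = Poly_Mapping.lookup (t_shift m (degree_op scale w + N.P m w)) n"
      by (simp add: lookup_t_shift lookup_add lookup_degree_op V.vector_space_axioms N.P_def lookup_sum
          lookup_pm_scale lookup_R_Suc exp_coeff_def atLeast0AtMost D_vanish del: of_int_diff)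
    finally show "Poly_Mapping.lookup (N0_d r scale \<rho> m w) n =
      Poly_Mapping.lookup (t_shift m (degree_op scale w + N.P m w)) n" .
  qed
  then show ?thesis
    by (simp add: laurent_act_times_single V.vector_space_axioms N.T_def N.F_eq R_def N.t.add add_ac)
qed

lemma N_basis_act_linear: "Vector_Spaces.linear (pm_scale scale) (pm_scale scale) (N_basis_act r scale \<rho> \<beta> x)"
proof (cases x)
  case (Vd m)
  then show ?thesis
    unfolding Vector_Spaces.linear_iff
    by (simp add: N_basis_act_Vd N.T_def N.F_linear N.t.add N.t.scale N.vector_space_axioms
        del: N_basis_act.simps)
next
  case Vc
  then show ?thesis unfolding Vector_Spaces.linear_iff by (simp add: N.vector_space_axioms)
qed

lemma N_act_linear: "Vector_Spaces.linear (pm_scale scale) (pm_scale scale) (N_act r scale \<rho> \<beta> u)"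
  unfolding N_act_def[abs_def]
  by (rule linear_lin_ext_fun[OF N.vector_space_axioms N_basis_act_linear])

lemma N_act_linear_left: "Vector_Spaces.linear vir_scale (pm_scale scale) (\<lambda>u. N_act r scale \<rho> \<beta> u w)"
  unfolding N_act_def by (rule linear_lin_ext[OF N.vector_space_axioms])

lemma N_act_basis: "N_act r scale \<rho> \<beta> (Poly_Mapping.single x 1) w = N_basis_act r scale \<rho> \<beta> x w"
  by (simp add: N_act_def lin_ext_single[OF N.vector_space_axioms])

lemma N_act_vir_d: "N_act r scale \<rho> \<beta> (vir_d m) w = N.T m w"
  by (simp add: vir_d_def N_act_basis N_basis_act_Vd del: N_basis_act.simps)

text \<open>
  Both sides are bilinear in \<open>u\<close> and \<open>v\<close>, so it suffices to compare them on basis vectors. There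
  the relation is \<open>T_bracket\<close>, as the central term acts as \<open>0\<close>.
\<close>

lemma N_act_bracket:
  "N_act r scale \<rho> \<beta> (vir_bracket u v) w =
    N_act r scale \<rho> \<beta> u (N_act r scale \<rho> \<beta> v w) - N_act r scale \<rho> \<beta> v (N_act r scale \<rho> \<beta> u w)"
proof -
  let ?A = "N_act r scale \<rho> \<beta>"
  interpret r: Vector_Spaces.linear "pm_scale scale" "pm_scale scale" "?A u" for u by (rule N_act_linear)
  interpret l: Vector_Spaces.linear vir_scale "pm_scale scale" "\<lambda>u. ?A u w" for w by (rule N_act_linear_left)
  have vc: "?A vir_c x = 0" for x
    by (simp add: vir_c_def N_act_basis)
  have basis: "?A (vir_bracket (Poly_Mapping.single x 1) (Poly_Mapping.single y 1)) w =
    ?A (Poly_Mapping.single x 1) (?A (Poly_Mapping.single y 1) w) -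
    ?A (Poly_Mapping.single y 1) (?A (Poly_Mapping.single x 1) w)" for x y
  proof (cases "x = Vc \<or> y = Vc")
    case True
    then show ?thesis
      by (auto simp: vir_c_def[symmetric] vir_bracket_central vc r.zero l.zero)
  next
    case False
    then obtain i j where "x = Vd i" "y = Vd j" by (cases x; cases y) auto
    then show ?thesis
      by (simp add: vir_d_def[symmetric] vir_brackets l.add l.scale l.zero vc N_act_vir_d N.T_bracket
          del: of_int_diff)
  qed
  have right: "?A (vir_bracket u (Poly_Mapping.single y 1)) w =
    ?A u (?A (Poly_Mapping.single y 1) w) - ?A (Poly_Mapping.single y 1) (?A u w)" for u y
  proof (rule linear_eq_on_vir_basis[where s = "pm_scale scale" and u = u
        and f = "\<lambda>u. ?A (vir_bracket u (Poly_Mapping.single y 1)) w"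
        and g = "\<lambda>u. ?A u (?A (Poly_Mapping.single y 1) w) - ?A (Poly_Mapping.single y 1) (?A u w)"])
    show "Vector_Spaces.linear vir_scale (pm_scale scale) (\<lambda>u. ?A (vir_bracket u (Poly_Mapping.single y 1)) w)"
      "Vector_Spaces.linear vir_scale (pm_scale scale)
        (\<lambda>u. ?A u (?A (Poly_Mapping.single y 1) w) - ?A (Poly_Mapping.single y 1) (?A u w))"
      by (auto simp: Vector_Spaces.linear_iff vir.vector_space_axioms N.vector_space_axioms
          vir_bracket_simps l.add l.scale r.add r.scale N.scale_right_diff_distrib)
  qed (rule basis)
  have lin: "Vector_Spaces.linear vir_scale (pm_scale scale) (\<lambda>v. ?A (vir_bracket u v) w)"
      "Vector_Spaces.linear vir_scale (pm_scale scale) (\<lambda>v. ?A u (?A v w) - ?A v (?A u w))"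
    by (auto simp: Vector_Spaces.linear_iff vir.vector_space_axioms N.vector_space_axioms
        vir_bracket_simps l.add l.scale r.add r.scale N.scale_right_diff_distrib)
  show "?A (vir_bracket u v) w = ?A u (?A v w) - ?A v (?A u w)"
    by (rule linear_eq_on_vir_basis[OF lin right])
qed

lemma N_lie_module: "lie_module virasoro (pm_scale scale) (N_act r scale \<rho> \<beta>)"
proof (intro lie_module.intro lie_algebra_virasoro N.vector_space_axioms lie_module_axioms.intro)
  fix x y :: vir and a and w :: "int \<Rightarrow>\<^sub>0 'm"
  interpret l: Vector_Spaces.linear vir_scale "pm_scale scale" "\<lambda>u. N_act r scale \<rho> \<beta> u w"
    by (rule N_act_linear_left)
  show "N_act r scale \<rho> \<beta> (x \<oplus>\<^bsub>virasoro\<^esub> y) w = N_act r scale \<rho> \<beta> x w + N_act r scale \<rho> \<beta> y w"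
    "N_act r scale \<rho> \<beta> (a \<odot>\<^bsub>virasoro\<^esub> x) w = pm_scale scale a (N_act r scale \<rho> \<beta> x w)"
    by (simp_all add: l.add l.scale)
  show "N_act r scale \<rho> \<beta> (x \<otimes>\<^bsub>virasoro\<^esub> y) w =
      N_act r scale \<rho> \<beta> x (N_act r scale \<rho> \<beta> y w) - N_act r scale \<rho> \<beta> y (N_act r scale \<rho> \<beta> x w)"
    unfolding virasoro_simps by (rule N_act_bracket)
qed (rule N_act_linear)

text \<open>
  Stability under \<open>t\<close> gives stability under \<open>\<beta>\<close>, and then \<open>R 0\<close> minus the action of \<open>\<beta>\<close> is
  \<open>degree_op\<close>. So \<open>U\<close> is graded, and the shifts identify all its components with the one of
  degree \<open>0\<close>, which is a nonzero submodule of \<open>M\<close>.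
\<close>

lemma t_R_stable_imp_UNIV:
  assumes "simple_lie_module (vir_a r) scale \<rho>"
    and U: "N.subspace U" and "x \<in> U" "x \<noteq> 0"
    and t: "\<And>k w. w \<in> U \<Longrightarrow> t_shift k w \<in> U" and R: "\<And>i w. w \<in> U \<Longrightarrow> R i w \<in> U"
  shows "U = UNIV"
proof -
  interpret M: simple_lie_module "vir_a r" scale \<rho> by (fact assms(1))
  have degree: "degree_op scale w \<in> U" if "w \<in> U" for w
  proof -
    have "laurent_act scale \<beta> w \<in> U"
      unfolding laurent_act_def lin_ext_def by (intro N.subspace_sum N.subspace_scale U t that)
    then have "R 0 w - laurent_act scale \<beta> w \<in> U" by (intro N.subspace_diff U R that)
    then show ?thesis by (simp add: R_def)
  qed
  define A where "A = {v. Poly_Mapping.single 0 v \<in> U}"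
  have A: "v \<in> A" if "Poly_Mapping.single n v \<in> U" for n v
    using t[OF that, of "- n"] by (simp add: A_def t_shift_single)
  have "V.subspace A"
    using N.subspace_0[OF U] N.subspace_add[OF U] N.subspace_scale[OF U]
    by (auto simp: V.subspace_def A_def single_add pm_scale_single[of scale, symmetric])
  moreover have "D i v \<in> A" if "v \<in> A" for i v
  proof -
    have "R (Suc i) (Poly_Mapping.single 0 v) = Poly_Mapping.single 0 (D i v)"
      by (rule poly_mapping_eqI) (simp add: lookup_R_Suc lookup_single when_def D.zero)
    then show ?thesis using R[of "Poly_Mapping.single 0 v" "Suc i"] that by (simp add: A_def)
  qed
  ultimately have "A = {0} \<or> A = UNIV"
    using d_bar_stable_imp_stable[OF lie_module_axioms, of A] by (intro M.simple) blast+
  moreover have "A \<noteq> {0}"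
  proof -
    obtain n where "Poly_Mapping.lookup x n \<noteq> 0"
      using \<open>x \<noteq> 0\<close> by (metis lookup_zero poly_mapping_eqI)
    moreover have "Poly_Mapping.lookup x n \<in> A"
      by (rule A[OF homogeneous_component_mem[OF V.vector_space_axioms U degree \<open>x \<in> U\<close>]])
    ultimately show ?thesis by auto
  qed
  ultimately have single: "Poly_Mapping.single n v \<in> U" for n v
    using t[of "Poly_Mapping.single 0 v" n] by (auto simp: A_def t_shift_single)
  have "w \<in> U" for w
    by (subst sum_single_lookup) (intro N.subspace_sum U single)
  then show ?thesis by auto
qed

lemma N_simple:
  assumes "r \<ge> 1" and simple: "simple_lie_module (vir_a r) scale \<rho>" and inj: "inj (D r)"
    and W: "N.subspace W" and stable: "\<And>u w. w \<in> W \<Longrightarrow> N_act r scale \<rho> \<beta> u w \<in> W"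
  shows "W = {0} \<or> W = UNIV"
proof (cases "W = {0}")
  case False
  then obtain w where w: "w \<in> W" "w \<noteq> 0" using N.subspace_0[OF W] by auto
  have T_W: "N.T m w \<in> W" if "w \<in> W" for m w
    using stable[OF that, of "vir_d m"] by (simp add: N_act_vir_d)
  have R_inj: "R (Suc r) y \<noteq> 0" if "y \<noteq> 0" for y
  proof -
    obtain n where "Poly_Mapping.lookup y n \<noteq> 0"
      using \<open>y \<noteq> 0\<close> by (metis lookup_zero poly_mapping_eqI)
    then have "Poly_Mapping.lookup (R (Suc r) y) n \<noteq> 0"
      using injD[OF inj, of _ 0] by (auto simp: lookup_R_Suc D.zero)
    then show ?thesis by auto
  qed
  have "R (Suc r) (R (Suc r) w) \<in> N.t_core W"
    using N.t_R_R_mem[OF _ W T_W w(1)] \<open>r \<ge> 1\<close> by (simp add: N.t_core_def)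
  moreover have "R (Suc r) (R (Suc r) w) \<noteq> 0"
    by (intro R_inj w(2))
  ultimately have "N.t_core W = UNIV"
    by (rule t_R_stable_imp_UNIV[OF simple N.subspace_t_core[OF W]])
      (simp_all add: N.t_core_t N.t_core_R[OF W T_W])
  then show ?thesis using N.t_core_subset[of W] by auto
qed simp

end

theorem theorem8:
  fixes r :: nat
    and scale :: "complex \<Rightarrow> 'm::ab_group_add \<Rightarrow> 'm"
    and \<rho> :: "vir set \<Rightarrow> 'm \<Rightarrow> 'm"
    and \<beta> :: laurent
  assumes "r \<ge> 1"
    and "simple_lie_module (vir_a r) scale \<rho>"
    and "inj (\<rho> (d_bar r r))"
    and "\<forall>a. \<beta> \<noteq> Poly_Mapping.single 0 a"
  shows "simple_lie_module virasoro (pm_scale scale) (N_act r scale \<rho> \<beta>)"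
proof -
  interpret M: simple_lie_module "vir_a r" scale \<rho> by (fact assms(2))
  interpret loop_module r scale \<rho> \<beta> by (rule loop_module.intro) (rule M.lie_module_axioms)
  obtain v :: 'm where "v \<noteq> 0" using M.nonzero by blast
  then have "Poly_Mapping.single (0::int) v \<noteq> 0" by (metis lookup_single_eq lookup_zero)
  then have nonzero: "\<exists>w :: int \<Rightarrow>\<^sub>0 'm. w \<noteq> 0" by (rule exI)
  show ?thesis
  proof (intro simple_lie_module.intro N_lie_module simple_lie_module_axioms.intro nonzero)
    fix W :: "(int \<Rightarrow>\<^sub>0 'm) set"
    assume "N.subspace W"
      and "\<And>u w. \<lbrakk>u \<in> carrier virasoro; w \<in> W\<rbrakk> \<Longrightarrow> N_act r scale \<rho> \<beta> u w \<in> W"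
    then show "W = {0} \<or> W = UNIV"
      by (intro N_simple[OF assms(1-3)]) simp_all
  qed
qed

end
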